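(* The operators $\Delta_q$ and $\hat Q$ on $\mathcal A$ commute with the action of the algebra $U_q(\mathrm{gl}_n)$ on $\mathcal A$: for every $X\in U_q(\mathrm{gl}_n)$ one has $\Delta_q L(X)=L(X)\Delta_q$ and $\hat Q L(X)=L(X)\hat Q$.
   Context: Fix an integer $n\ge 1$ and a nonzero complex number $q$ that is not a root of unity (with a fixed square root $q^{1/2}$). For integers $a$ put $[a]=(q^a-q^{-a})/(q-q^{-1})$. $\mathcal A$ is the unital associative $\mathbb C$-algebra generated by $z_1,\dots,z_n,w_1,\dots,w_n$ with relations $z_iz_j=qz_jz_i$ and $w_iw_j=q^{-1}w_jw_i$ for $i<j$; $w_jz_i=qz_iw_j$ for $i\ne j$; $w_kz_k=z_kw_k+(1-q^2)\sum_{s<k}z_sw_s$. Both the monomials $z_1^{r_1}\cdots z_n^{r_n}w_1^{s_1}\cdots w_n^{s_n}$ and the monomials $w_1^{r_1}\cdots w_n^{r_n}z_1^{s_1}\cdots z_n^{s_n}$ form bases of $\mathcal A$. Linear operators $\partial_i,\bar\partial_i$ on $\mathcal A$ are defined on these bases by $\partial_i(z_1^{r_1}\cdots z_n^{r_n}w_1^{s_1}\cdots w_n^{s_n})=q^{r_{i+1}+\cdots+r_n}[r_i]\,z_1^{r_1}\cdots z_i^{r_i-1}\cdots z_n^{r_n}w_1^{s_1}\cdots w_n^{s_n}$ and $\bar\partial_i(w_1^{r_1}\cdots w_n^{r_n}z_1^{s_1}\cdots z_n^{s_n})=q^{-(r_{i+1}+\cdots+r_n)}[r_i]\,w_1^{r_1}\cdots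 w_i^{r_i-1}\cdots w_n^{r_n}z_1^{s_1}\cdots z_n^{s_n}$ (both are $0$ if $r_i=0$). The $q$-Laplace operator is $\Delta_q=\sum_{i=1}^n\partial_i\bar\partial_i$ $(=\sum_{i=1}^n q^{2(i-1)}\bar\partial_i\partial_i)$. Put $Q=\sum_{i=1}^n z_iw_i$ (a central element of $\mathcal A$) and let $\hat Q$ be the operator of multiplication by $Q$. $U_q(\mathrm{gl}_n)$ is the algebra generated by pairwise commuting invertible $k_i^{\pm1/2}$ ($1\le i\le n$) and $e_j,f_j$ ($1\le j\le n-1$) with $k_i^{1/2}e_jk_i^{-1/2}=q^{a_{ij}/2}e_j$, $k_i^{1/2}f_jk_i^{-1/2}=q^{-a_{ij}/2}f_j$, where $a_{jj}=1$, $a_{j+1,j}=-1$, $a_{ij}=0$ otherwise; $[e_i,f_j]=\delta_{ij}(k_ik_{i+1}^{-1}-k_i^{-1}k_{i+1})/(q-q^{-1})$; $e_i^2e_{i\pm1}-(q+q^{-1})e_ie_{i\pm1}e_i+e_{i\pm1}e_i^2=0$ and the same for the $f$'s; $[e_i,e_j]=[f_i,f_j]=0$ for $|i-j|>1$. Its comultiplication is $k_i^{\pm 1/2}\mapsto k_i^{\pm 1/2}\otimes k_i^{\pm 1/2}$, $e_i\mapsto e_i\otimes k_i^{-1/2}k_{i+1}^{1/2}+k_i^{1/2}k_{i+1}^{-1/2}\otimes e_i$, $f_i\mapsto f_i\otimes k_i^{-1/2}k_{i+1}^{1/2}+k_i^{1/2}k_{i+1}^{-1/2}\otimes f_i$;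 the counit is $\varepsilon(k_i)=1$, $\varepsilon(e_i)=\varepsilon(f_i)=0$. The representation $L$ of $U_q(\mathrm{gl}_n)$ on $\mathcal A$, $L(X)p=X\triangleright p$, is determined by $X\triangleright 1=\varepsilon(X)1$, $k_i^{1/2}\triangleright z_j=q^{\delta_{ij}/2}z_j$, $e_i\triangleright z_j=\delta_{j,i+1}z_{j-1}$, $f_i\triangleright z_j=\delta_{j,i}z_{j+1}$, $k_i^{1/2}\triangleright w_j=q^{-\delta_{ij}/2}w_j$, $e_i\triangleright w_j=-\delta_{j,i}q^{-1}w_{j+1}$, $f_i\triangleright w_j=-\delta_{j,i+1}q\,w_{j-1}$, and $X\triangleright(p_1p_2)=\sum(X_{(1)}\triangleright p_1)(X_{(2)}\triangleright p_2)$ (Sweedler notation). *)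

theory Defs
  imports
    Complex_Main
    "HOL-Library.Poly_Mapping"
    "HOL-Library.Product_Plus"
    "HOL-Algebra.QuotRing"
    "HOL-Algebra.Module"
begin

datatype 'g fword = Word (letters: "'g list")

instantiation fword :: (type) monoid_add
begin

definition zero_fword :: "'a fword" where
  "0 = Word []"

definition plus_fword :: "'a fword \<Rightarrow> 'a fword \<Rightarrow> 'a fword" where
  "u + v = Word (letters u @ letters v)"

instance
  by standard (simp_all add: zero_fword_def plus_fword_def)

end

text \<open>
  The additive notation for words (a noncommutative monoid) is what equips \<^typ>\<open>'g fword \<Rightarrow>\<^sub>0 complex\<close>
  with the convolution product of \<^theory>\<open>HOL-Library.Poly_Mapping\<close>, which makes it the free unital
  associative algebra on \<^typ>\<open>'g\<close>.
\<close>

type_synonym 'g falg = "'g fword \<Rightarrow>\<^sub>0 complex"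

definition fgen :: "'g \<Rightarrow> 'g falg" where
  "fgen g = Poly_Mapping.single (Word [g]) 1"

definition fconst :: "complex \<Rightarrow> 'm::monoid_add \<Rightarrow>\<^sub>0 complex" where
  "fconst c = Poly_Mapping.single 0 c"

text \<open>The free algebra on the generators in \<open>G\<close>.\<close>

definition free_alg :: "'g set \<Rightarrow> 'g falg ring" where
  "free_alg G =
    \<lparr>carrier = {p. \<forall>u\<in>Poly_Mapping.keys p. set (letters u) \<subseteq> G},
     mult = (*), one = 1, zero = 0, add = (+)\<rparr>"

text \<open>
  The algebra with generators \<open>G\<close> and defining relations \<open>R\<close>; a pair \<open>(x, y)\<close> in \<open>R\<close> stands for the
  relation \<open>x = y\<close>. Its elements are cosets of the two-sided ideal generated by the differences.
\<close>

definition rel_ideal :: "'g set \<Rightarrow> ('g falg \<times> 'g falg) set \<Rightarrow> 'g falg set" where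
  "rel_ideal G R = Idl\<^bsub>free_alg G\<^esub> {x - y | x y. (x, y) \<in> R}"

definition pres_class :: "'g set \<Rightarrow> ('g falg \<times> 'g falg) set \<Rightarrow> 'g falg \<Rightarrow> 'g falg set" where
  "pres_class G R p = rel_ideal G R +>\<^bsub>free_alg G\<^esub> p"

definition presented_alg ::
  "'g set \<Rightarrow> ('g falg \<times> 'g falg) set \<Rightarrow> (complex, 'g falg set) module" where
  "presented_alg G R =
    \<lparr>carrier = carrier (free_alg G Quot rel_ideal G R),
     mult = mult (free_alg G Quot rel_ideal G R),
     one = one (free_alg G Quot rel_ideal G R),
     zero = zero (free_alg G Quot rel_ideal G R),
     add = add (free_alg G Quot rel_ideal G R),
     smult = (\<lambda>c X. mult (free_alg G Quot rel_ideal G R) (pres_class G R (fconst c)) X)\<rparr>"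

definition linear_operator :: "(complex, 'a) module \<Rightarrow> ('a \<Rightarrow> 'a) \<Rightarrow> bool" where
  "linear_operator V T \<longleftrightarrow>
    T \<in> carrier V \<rightarrow> carrier V \<and>
    (\<forall>x\<in>carrier V. \<forall>y\<in>carrier V. T (x \<oplus>\<^bsub>V\<^esub> y) = T x \<oplus>\<^bsub>V\<^esub> T y) \<and>
    (\<forall>c. \<forall>x\<in>carrier V. T (c \<odot>\<^bsub>V\<^esub> x) = c \<odot>\<^bsub>V\<^esub> T x)"

definition algebra_representation ::
  "(complex, 'u) module \<Rightarrow> (complex, 'a) module \<Rightarrow> ('u \<Rightarrow> 'a \<Rightarrow> 'a) \<Rightarrow> bool" where
  "algebra_representation U V L \<longleftrightarrow>
    (\<forall>X\<in>carrier U. linear_operator V (L X)) \<and>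
    (\<forall>p\<in>carrier V. L \<one>\<^bsub>U\<^esub> p = p) \<and>
    (\<forall>X\<in>carrier U. \<forall>Y\<in>carrier U. \<forall>p\<in>carrier V.
      L (X \<otimes>\<^bsub>U\<^esub> Y) p = L X (L Y p) \<and> L (X \<oplus>\<^bsub>U\<^esub> Y) p = L X p \<oplus>\<^bsub>V\<^esub> L Y p) \<and>
    (\<forall>c. \<forall>X\<in>carrier U. \<forall>p\<in>carrier V. L (c \<odot>\<^bsub>U\<^esub> X) p = c \<odot>\<^bsub>V\<^esub> L X p)"

text \<open>
  The algebra homomorphism from the free algebra to \<^typ>\<open>'b\<close> that sends the generator \<open>g\<close> to \<open>h g\<close>
  and the scalar \<open>c\<close> to \<open>\<iota> c\<close>.
\<close>

definition free_lift :: "(complex \<Rightarrow> 'b::ring_1) \<Rightarrow> ('g \<Rightarrow> 'b) \<Rightarrow> 'g falg \<Rightarrow> 'b" where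
  "free_lift \<iota> h x =
    (\<Sum>u\<in>Poly_Mapping.keys x. \<iota> (Poly_Mapping.lookup x u) * prod_list (map h (letters u)))"


section \<open>The algebra generated by the z's and w's\<close>

definition qnum :: "complex \<Rightarrow> int \<Rightarrow> complex" where
  "qnum q a = (q powi a - q powi (- a)) / (q - inverse q)"

datatype agen = Zgen nat | Wgen nat

abbreviation fz :: "nat \<Rightarrow> agen falg" where "fz i \<equiv> fgen (Zgen i)"
abbreviation fw :: "nat \<Rightarrow> agen falg" where "fw i \<equiv> fgen (Wgen i)"

definition A_gens :: "nat \<Rightarrow> agen set" where
  "A_gens n = Zgen ` {1..n} \<union> Wgen ` {1..n}"

inductive_set A_rels :: "nat \<Rightarrow> complex \<Rightarrow> (agen falg \<times> agen falg) set"
  for n :: nat and q :: complex where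
  zz: "1 \<le> i \<Longrightarrow> i < j \<Longrightarrow> j \<le> n \<Longrightarrow> (fz i * fz j, fconst q * fz j * fz i) \<in> A_rels n q"
| ww: "1 \<le> i \<Longrightarrow> i < j \<Longrightarrow> j \<le> n \<Longrightarrow> (fw i * fw j, fconst (inverse q) * fw j * fw i) \<in> A_rels n q"
| wz: "i \<in> {1..n} \<Longrightarrow> j \<in> {1..n} \<Longrightarrow> i \<noteq> j \<Longrightarrow> (fw j * fz i, fconst q * fz i * fw j) \<in> A_rels n q"
| wz_diag: "k \<in> {1..n} \<Longrightarrow>
    (fw k * fz k, fz k * fw k + fconst (1 - q\<^sup>2) * (\<Sum>s\<in>{1..<k}. fz s * fw s)) \<in> A_rels n q"

definition A_alg :: "nat \<Rightarrow> complex \<Rightarrow> (complex, agen falg set) module" where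
  "A_alg n q = presented_alg (A_gens n) (A_rels n q)"

definition A_cls :: "nat \<Rightarrow> complex \<Rightarrow> agen falg \<Rightarrow> agen falg set" where
  "A_cls n q p = pres_class (A_gens n) (A_rels n q) p"

definition zmon :: "nat \<Rightarrow> (nat \<Rightarrow> nat) \<Rightarrow> agen falg" where
  "zmon n r = prod_list (map (\<lambda>i. fz i ^ r i) [1..<Suc n])"

definition wmon :: "nat \<Rightarrow> (nat \<Rightarrow> nat) \<Rightarrow> agen falg" where
  "wmon n r = prod_list (map (\<lambda>i. fw i ^ r i) [1..<Suc n])"

text \<open>
  The operators are given by their values on monomial bases, hence each of the following predicates
  determines its operator uniquely on the carrier. For \<open>r i = 0\<close> the right-hand sides vanish because \<open>qnum q 0 = 0\<close>.
\<close>

definition is_partial :: "nat \<Rightarrow> complex \<Rightarrow> nat \<Rightarrow> (agen falg set \<Rightarrow> agen falg set) \<Rightarrow> bool" where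
  "is_partial n q i D \<longleftrightarrow>
    linear_operator (A_alg n q) D \<and>
    (\<forall>r s. D (A_cls n q (zmon n r * wmon n s)) =
      (q ^ (\<Sum>j\<in>{i+1..n}. r j) * qnum q (int (r i))) \<odot>\<^bsub>A_alg n q\<^esub>
        A_cls n q (zmon n (r(i := r i - 1)) * wmon n s))"

definition is_partial_bar :: "nat \<Rightarrow> complex \<Rightarrow> nat \<Rightarrow> (agen falg set \<Rightarrow> agen falg set) \<Rightarrow> bool" where
  "is_partial_bar n q i D \<longleftrightarrow>
    linear_operator (A_alg n q) D \<and>
    (\<forall>r s. D (A_cls n q (wmon n r * zmon n s)) =
      (q powi (- int (\<Sum>j\<in>{i+1..n}. r j)) * qnum q (int (r i))) \<odot>\<^bsub>A_alg n q\<^esub>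
        A_cls n q (wmon n (r(i := r i - 1)) * zmon n s))"

definition q_laplace ::
  "nat \<Rightarrow> complex \<Rightarrow> (nat \<Rightarrow> agen falg set \<Rightarrow> agen falg set) \<Rightarrow>
    (nat \<Rightarrow> agen falg set \<Rightarrow> agen falg set) \<Rightarrow> agen falg set \<Rightarrow> agen falg set" where
  "q_laplace n q D Dbar p = (\<Oplus>\<^bsub>A_alg n q\<^esub>i\<in>{1..n}. D i (Dbar i p))"

definition Q_elem :: "nat \<Rightarrow> complex \<Rightarrow> agen falg set" where
  "Q_elem n q = A_cls n q (\<Sum>i\<in>{1..n}. fz i * fw i)"

definition Q_hat :: "nat \<Rightarrow> complex \<Rightarrow> agen falg set \<Rightarrow> agen falg set" where
  "Q_hat n q p = Q_elem n q \<otimes>\<^bsub>A_alg n q\<^esub> p"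


section \<open>The quantum algebra of type gl\<close>

text \<open>
  \<open>Kgen i\<close> and \<open>Kinvgen i\<close> stand for \<open>k\<^sub>i\<close> to the powers \<open>1/2\<close> and \<open>-1/2\<close>. The parameter \<open>h\<close> below is
  the fixed square root of \<open>q\<close>.
\<close>

datatype ugen = Kgen nat | Kinvgen nat | Egen nat | Fgen nat

abbreviation fK :: "nat \<Rightarrow> ugen falg" where "fK i \<equiv> fgen (Kgen i)"
abbreviation fKinv :: "nat \<Rightarrow> ugen falg" where "fKinv i \<equiv> fgen (Kinvgen i)"
abbreviation fE :: "nat \<Rightarrow> ugen falg" where "fE j \<equiv> fgen (Egen j)"
abbreviation fF :: "nat \<Rightarrow> ugen falg" where "fF j \<equiv> fgen (Fgen j)"

definition U_gens :: "nat \<Rightarrow> ugen set" where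
  "U_gens n = Kgen ` {1..n} \<union> Kinvgen ` {1..n} \<union> Egen ` {1..<n} \<union> Fgen ` {1..<n}"

definition gl_weight :: "nat \<Rightarrow> nat \<Rightarrow> int" where
  "gl_weight i j = (if i = j then 1 else if i = j + 1 then -1 else 0)"

inductive_set U_rels :: "nat \<Rightarrow> complex \<Rightarrow> complex \<Rightarrow> (ugen falg \<times> ugen falg) set"
  for n :: nat and q h :: complex where
  K_Kinv: "i \<in> {1..n} \<Longrightarrow> (fK i * fKinv i, 1) \<in> U_rels n q h"
| Kinv_K: "i \<in> {1..n} \<Longrightarrow> (fKinv i * fK i, 1) \<in> U_rels n q h"
| K_K: "i \<in> {1..n} \<Longrightarrow> j \<in> {1..n} \<Longrightarrow> (fK i * fK j, fK j * fK i) \<in> U_rels n q h"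
| K_E: "i \<in> {1..n} \<Longrightarrow> j \<in> {1..<n} \<Longrightarrow>
    (fK i * fE j * fKinv i, fconst (h powi gl_weight i j) * fE j) \<in> U_rels n q h"
| K_F: "i \<in> {1..n} \<Longrightarrow> j \<in> {1..<n} \<Longrightarrow>
    (fK i * fF j * fKinv i, fconst (h powi (- gl_weight i j)) * fF j) \<in> U_rels n q h"
| E_F: "i \<in> {1..<n} \<Longrightarrow> j \<in> {1..<n} \<Longrightarrow>
    (fE i * fF j - fF j * fE i,
     if i = j
     then fconst (1 / (q - inverse q)) *
       ((fK i)\<^sup>2 * (fKinv (i+1))\<^sup>2 - (fKinv i)\<^sup>2 * (fK (i+1))\<^sup>2)
     else 0) \<in> U_rels n q h"
| serre_E: "i \<in> {1..<n} \<Longrightarrow> j \<in> {1..<n} \<Longrightarrow> j = i + 1 \<or> i = j + 1 \<Longrightarrow>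
    ((fE i)\<^sup>2 * fE j - fconst (q + inverse q) * fE i * fE j * fE i + fE j * (fE i)\<^sup>2, 0)
      \<in> U_rels n q h"
| serre_F: "i \<in> {1..<n} \<Longrightarrow> j \<in> {1..<n} \<Longrightarrow> j = i + 1 \<or> i = j + 1 \<Longrightarrow>
    ((fF i)\<^sup>2 * fF j - fconst (q + inverse q) * fF i * fF j * fF i + fF j * (fF i)\<^sup>2, 0)
      \<in> U_rels n q h"
| E_E: "i \<in> {1..<n} \<Longrightarrow> j \<in> {1..<n} \<Longrightarrow> i + 1 < j \<or> j + 1 < i \<Longrightarrow>
    (fE i * fE j, fE j * fE i) \<in> U_rels n q h"
| F_F: "i \<in> {1..<n} \<Longrightarrow> j \<in> {1..<n} \<Longrightarrow> i + 1 < j \<or> j + 1 < i \<Longrightarrow>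
    (fF i * fF j, fF j * fF i) \<in> U_rels n q h"

definition U_alg :: "nat \<Rightarrow> complex \<Rightarrow> complex \<Rightarrow> (complex, ugen falg set) module" where
  "U_alg n q h = presented_alg (U_gens n) (U_rels n q h)"

definition U_cls :: "nat \<Rightarrow> complex \<Rightarrow> complex \<Rightarrow> ugen falg \<Rightarrow> ugen falg set" where
  "U_cls n q h x = pres_class (U_gens n) (U_rels n q h) x"

text \<open>
  The algebra of the product monoid \<^typ>\<open>ugen fword \<times> ugen fword\<close> is the tensor square of the free algebra,
  the pair \<open>(u, v)\<close> being the tensor of the words \<open>u\<close> and \<open>v\<close>. The comultiplication and the counit
  are defined on the free algebra, on representatives of the elements of \<open>U_alg n q h\<close>.
\<close>

type_synonym utens = "(ugen fword \<times> ugen fword) \<Rightarrow>\<^sub>0 complex"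

definition tens :: "ugen falg \<Rightarrow> ugen falg \<Rightarrow> utens" where
  "tens x y = (\<Sum>u\<in>Poly_Mapping.keys x. \<Sum>v\<in>Poly_Mapping.keys y.
    Poly_Mapping.single (u, v) (Poly_Mapping.lookup x u * Poly_Mapping.lookup y v))"

fun comult_gen :: "ugen \<Rightarrow> utens" where
  "comult_gen (Kgen i) = tens (fK i) (fK i)"
| "comult_gen (Kinvgen i) = tens (fKinv i) (fKinv i)"
| "comult_gen (Egen i) = tens (fE i) (fKinv i * fK (i+1)) + tens (fK i * fKinv (i+1)) (fE i)"
| "comult_gen (Fgen i) = tens (fF i) (fKinv i * fK (i+1)) + tens (fK i * fKinv (i+1)) (fF i)"

definition comult :: "ugen falg \<Rightarrow> utens" where
  "comult = free_lift fconst comult_gen"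

fun counit_gen :: "ugen \<Rightarrow> complex" where
  "counit_gen (Kgen i) = 1"
| "counit_gen (Kinvgen i) = 1"
| "counit_gen (Egen i) = 0"
| "counit_gen (Fgen i) = 0"

definition counit :: "ugen falg \<Rightarrow> complex" where
  "counit = free_lift (\<lambda>c. c) counit_gen"

text \<open>
  The module algebra structure. In the third condition the right-hand side is the Sweedler sum of
  the element represented by \<open>x\<close>.
\<close>

definition is_L_action ::
  "nat \<Rightarrow> complex \<Rightarrow> complex \<Rightarrow> (ugen falg set \<Rightarrow> agen falg set \<Rightarrow> agen falg set) \<Rightarrow> bool" where
  "is_L_action n q h L \<longleftrightarrow>
    algebra_representation (U_alg n q h) (A_alg n q) L \<and>
    (\<forall>x\<in>carrier (free_alg (U_gens n)).
      L (U_cls n q h x) \<one>\<^bsub>A_alg n q\<^esub> = counit x \<odot>\<^bsub>A_alg n q\<^esub> \<one>\<^bsub>A_alg n q\<^esub>) \<and>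
    (\<forall>x\<in>carrier (free_alg (U_gens n)). \<forall>p1\<in>carrier (A_alg n q). \<forall>p2\<in>carrier (A_alg n q).
      L (U_cls n q h x) (p1 \<otimes>\<^bsub>A_alg n q\<^esub> p2) =
        (\<Oplus>\<^bsub>A_alg n q\<^esub>t\<in>Poly_Mapping.keys (comult x).
          Poly_Mapping.lookup (comult x) t \<odot>\<^bsub>A_alg n q\<^esub>
            (L (U_cls n q h (Poly_Mapping.single (fst t) 1)) p1 \<otimes>\<^bsub>A_alg n q\<^esub>
             L (U_cls n q h (Poly_Mapping.single (snd t) 1)) p2))) \<and>
    (\<forall>i\<in>{1..n}. \<forall>j\<in>{1..n}.
      L (U_cls n q h (fK i)) (A_cls n q (fz j)) =
        A_cls n q (fconst (if i = j then h else 1) * fz j) \<and>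
      L (U_cls n q h (fK i)) (A_cls n q (fw j)) =
        A_cls n q (fconst (if i = j then inverse h else 1) * fw j)) \<and>
    (\<forall>i\<in>{1..<n}. \<forall>j\<in>{1..n}.
      L (U_cls n q h (fE i)) (A_cls n q (fz j)) =
        A_cls n q (if j = i + 1 then fz (j - 1) else 0) \<and>
      L (U_cls n q h (fF i)) (A_cls n q (fz j)) =
        A_cls n q (if j = i then fz (j + 1) else 0) \<and>
      L (U_cls n q h (fE i)) (A_cls n q (fw j)) =
        A_cls n q (if j = i then fconst (- inverse q) * fw (j + 1) else 0) \<and>
      L (U_cls n q h (fF i)) (A_cls n q (fw j)) =
        A_cls n q (if j = i + 1 then fconst (- q) * fw (j - 1) else 0))"

end

theory Submission
  imports Defs
begin

text \<open>
  Both factors of \<open>\<A>\<close> are quantum coordinate spaces, the \<open>w\<close>'s with \<open>q\<close> replaced by \<open>q\<inverse>\<close>. On either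
  of them \<open>e\<^sub>i\<close> and \<open>f\<^sub>i\<close> act as skew derivations \<open>E\<close>, \<open>E(xy) = E(x) K\<inverse>(y) + K(x) E(y)\<close>
  with \<open>K = k\<^sub>i\<^sup>1\<^sup>/\<^sup>2 k\<^sub>i\<^sub>+\<^sub>1\<^sup>-\<^sup>1\<^sup>/\<^sup>2\<close>, which only move one of the coordinates \<open>x\<^sub>i\<close>, \<open>x\<^sub>i\<^sub>+\<^sub>1\<close> to the other. On ordered
  monomials this gives commutation rules, for \<open>E = e\<^sub>i\<close> for example
  \<open>\<partial>\<^sub>i E = q\<^sup>1\<^sup>/\<^sup>2 E \<partial>\<^sub>i + q\<^sup>-\<^sup>1\<^sup>/\<^sup>2 \<partial>\<^sub>i\<^sub>+\<^sub>1 K\<inverse>\<close>; in \<open>\<Sum> \<partial>\<^sub>j \<partial>'\<^sub>j\<close>, where \<open>\<partial>'\<close> is the partial derivative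
  on the \<open>w\<close> side, the two resulting cross terms cancel. No linear independence of the monomials is
  used, only that they span. For \<open>Q\<close> one has \<open>E Q = 0\<close> and \<open>K Q = Q\<close>, so multiplication by \<open>Q\<close>
  commutes with \<open>E\<close>.
\<close>

section \<open>Algebras over the complex numbers and ordered monomials\<close>

text \<open>The \<open>X\<close> for which \<open>L X\<close> commutes with both operators are
  closed under linear combinations and products, so generators suffice. The obstacle is that
  \<open>D j\<close> is prescribed on monomials with the z's on the left and \<open>Dbar j\<close>
  on monomials with the w's on the left, so no single family of monomials evaluates
  \<open>D j (Dbar j p)\<close>. Each kind of derivative is therefore moved past \<open>E\<close> in
  its own ordering, giving operator identities on all of the algebra, and only these are composed.
  In either ordering the right-hand factor is inert: the derivative ignores it, and \<open>E\<close>
  need only send its ordered monomials to multiples of ordered monomials. One calculation with a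
  parameter \<open>u\<close> serves both orderings, with \<open>u = h\<close> for the z's and
  \<open>u = inverse h\<close> for the w's; since e_i decreases indices on the z's and increases
  them on the w's, it is done for both directions. A cross term appears when [a+1] is split into a
  multiple of [a] and a pure power of q.\<close>

locale complex_algebra = ring R for R :: "(complex, 'a) module" (structure) +
  assumes smult_closed [simp]: "x \<in> carrier R \<Longrightarrow> c \<odot> x \<in> carrier R"
    and smult_add: "x \<in> carrier R \<Longrightarrow> y \<in> carrier R \<Longrightarrow> c \<odot> (x \<oplus> y) = c \<odot> x \<oplus> c \<odot> y"
    and add_smult: "x \<in> carrier R \<Longrightarrow> (c + d) \<odot> x = c \<odot> x \<oplus> d \<odot> x"
    and smult_smult [simp]: "x \<in> carrier R \<Longrightarrow> c \<odot> (d \<odot> x) = (c * d) \<odot> x"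
    and smult_one [simp]: "x \<in> carrier R \<Longrightarrow> 1 \<odot> x = x"
    and smult_mult_left [simp]:
      "x \<in> carrier R \<Longrightarrow> y \<in> carrier R \<Longrightarrow> (c \<odot> x) \<otimes> y = c \<odot> (x \<otimes> y)"
    and smult_mult_right [simp]:
      "x \<in> carrier R \<Longrightarrow> y \<in> carrier R \<Longrightarrow> x \<otimes> (c \<odot> y) = c \<odot> (x \<otimes> y)"
begin

lemma zero_smult [simp]: "x \<in> carrier R \<Longrightarrow> 0 \<odot> x = \<zero>"
proof -
  assume x: "x \<in> carrier R"
  have "0 \<odot> x \<oplus> 0 \<odot> x = 0 \<odot> x" using add_smult[OF x, of 0 0] by simp
  then show ?thesis using x
    by (metis add.r_cancel_one' smult_closed)
qed

lemma smult_zero [simp]: "c \<odot> \<zero> = \<zero>"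
proof -
  have "c \<odot> \<zero> = c \<odot> (0 \<odot> \<zero>)" by simp
  then show ?thesis by (subst (asm) smult_smult) auto
qed

lemma smult_cancel: "c \<noteq> 0 \<Longrightarrow> x \<in> carrier R \<Longrightarrow> c \<odot> x = y \<Longrightarrow> x = (1 / c) \<odot> y"
  by auto

lemma smult_sum_cong: "x \<in> carrier R \<Longrightarrow> a = b + c \<Longrightarrow> b \<odot> x \<oplus> c \<odot> x = a \<odot> x"
  by (simp add: add_smult)

lemma lin_closed [simp]: "linear_operator R T \<Longrightarrow> x \<in> carrier R \<Longrightarrow> T x \<in> carrier R"
  by (auto simp: linear_operator_def)

lemma lin_add: "linear_operator R T \<Longrightarrow> x \<in> carrier R \<Longrightarrow> y \<in> carrier R \<Longrightarrow> T (x \<oplus> y) = T x \<oplus> T y"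
  by (auto simp: linear_operator_def)

lemma lin_smult: "linear_operator R T \<Longrightarrow> x \<in> carrier R \<Longrightarrow> T (c \<odot> x) = c \<odot> T x"
  by (auto simp: linear_operator_def)

lemma lin_zero: "linear_operator R T \<Longrightarrow> T \<zero> = \<zero>"
  using lin_smult[of T \<zero> 0] by simp

lemma lin_finsum:
  assumes "linear_operator R T" "finite S" "\<And>i. i \<in> S \<Longrightarrow> f i \<in> carrier R"
  shows "T (\<Oplus>i\<in>S. f i) = (\<Oplus>i\<in>S. T (f i))"
  using assms(2,3)
proof (induction S rule: finite_induct)
  case empty
  then show ?case using lin_zero[OF assms(1)] by simp
next
  case (insert a S)
  then show ?case using assms(1) by (simp add: Pi_def lin_add)
qed

lemma lin_comp: "linear_operator R S \<Longrightarrow> linear_operator R T \<Longrightarrow> linear_operator R (\<lambda>p. S (T p))"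
  unfolding linear_operator_def by (auto simp: Pi_def)

lemma lin_plus: "linear_operator R S \<Longrightarrow> linear_operator R T \<Longrightarrow> linear_operator R (\<lambda>p. S p \<oplus> T p)"
  unfolding linear_operator_def by (auto simp: Pi_def smult_add a_ac)

lemma lin_scale: "linear_operator R T \<Longrightarrow> linear_operator R (\<lambda>p. c \<odot> T p)"
  unfolding linear_operator_def by (auto simp: Pi_def smult_add mult.commute)

lemma lin_id: "linear_operator R (\<lambda>p. p)"
  unfolding linear_operator_def by auto

lemma lin_lmult: "a \<in> carrier R \<Longrightarrow> linear_operator R (\<lambda>p. a \<otimes> p)"
  unfolding linear_operator_def by (auto simp: r_distr)

section \<open>Linear spans and operators determined on a spanning set\<close>

inductive_set lspan :: "'a set \<Rightarrow> 'a set" for M where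
  base: "x \<in> M \<Longrightarrow> x \<in> lspan M"
| zero: "\<zero> \<in> lspan M"
| add: "x \<in> lspan M \<Longrightarrow> y \<in> lspan M \<Longrightarrow> x \<oplus> y \<in> lspan M"
| smult: "x \<in> lspan M \<Longrightarrow> c \<odot> x \<in> lspan M"

lemma lspan_closed: "M \<subseteq> carrier R \<Longrightarrow> x \<in> lspan M \<Longrightarrow> x \<in> carrier R"
  by (rotate_tac 1, induction rule: lspan.induct) auto

lemma lspan_image:
  assumes "M \<subseteq> carrier R" "linear_operator R T" "\<And>x. x \<in> M \<Longrightarrow> T x \<in> lspan N" "x \<in> lspan M"
  shows "T x \<in> lspan N"
  using assms(4)
  by (induction rule: lspan.induct)
    (auto simp: lin_zero[OF assms(2)] lin_add[OF assms(2)] lin_smult[OF assms(2)]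
      lspan_closed[OF assms(1)] assms(3) intro: lspan.intros)

lemma lspan_finsum:
  assumes "M \<subseteq> carrier R" "finite S" "\<And>i. i \<in> S \<Longrightarrow> f i \<in> lspan M"
  shows "(\<Oplus>i\<in>S. f i) \<in> lspan M"
  using assms(2,3)
  by (induction S rule: finite_induct)
    (auto simp: Pi_def lspan_closed[OF assms(1)] intro: lspan.intros)

lemma lin_eq_lspan:
  assumes "M \<subseteq> carrier R" "linear_operator R S" "linear_operator R T"
    and "\<And>x. x \<in> M \<Longrightarrow> S x = T x" "x \<in> lspan M"
  shows "S x = T x"
  using assms(5)
  by (induction rule: lspan.induct)
    (auto simp: lin_zero[OF assms(2)] lin_add[OF assms(2)] lin_smult[OF assms(2)]
      lin_zero[OF assms(3)] lin_add[OF assms(3)] lin_smult[OF assms(3)]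
      lspan_closed[OF assms(1)] assms(4))

section \<open>Ordered monomials and the endomorphisms that act on them diagonally\<close>

primrec omon :: "(nat \<Rightarrow> 'a) \<Rightarrow> nat \<Rightarrow> (nat \<Rightarrow> nat) \<Rightarrow> 'a" where
  "omon x 0 r = \<one>"
| "omon x (Suc m) r = omon x m r \<otimes> x (Suc m) [^] r (Suc m)"

lemma mon_closed [simp]:
  "(\<And>i. i \<in> {1..m} \<Longrightarrow> x i \<in> carrier R) \<Longrightarrow> omon x m r \<in> carrier R"
  by (induction m) auto

lemma mon_cong: "(\<And>i. i \<in> {1..m} \<Longrightarrow> r i = s i) \<Longrightarrow> omon x m r = omon x m s"
  by (induction m) auto

lemma mon_zero: "omon x m (\<lambda>_. 0) = \<one>"
  by (induction m) auto

text \<open>Unital algebra endomorphisms: this is how group-like elements such as k_i^(1/2) and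
  their products act.\<close>

definition multiplicative :: "('a \<Rightarrow> 'a) \<Rightarrow> bool" where
  "multiplicative K \<longleftrightarrow> linear_operator R K \<and> K \<one> = \<one> \<and>
    (\<forall>x\<in>carrier R. \<forall>y\<in>carrier R. K (x \<otimes> y) = K x \<otimes> K y)"

lemma multD [simp]:
  assumes "multiplicative K"
  shows "linear_operator R K" "K \<one> = \<one>"
    "x \<in> carrier R \<Longrightarrow> y \<in> carrier R \<Longrightarrow> K (x \<otimes> y) = K x \<otimes> K y"
  using assms by (auto simp: multiplicative_def)

lemma smult_pow [simp]: "x \<in> carrier R \<Longrightarrow> (c \<odot> x) [^] (k::nat) = (c ^ k) \<odot> (x [^] k)"
  by (induction k) (auto simp: mult.commute)

lemma mult_pow: "multiplicative K \<Longrightarrow> x \<in> carrier R \<Longrightarrow> K (x [^] (k::nat)) = K x [^] k"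
  by (induction k) auto

lemma mult_mon:
  assumes "multiplicative K" "\<And>i. i \<in> {1..m} \<Longrightarrow> x i \<in> carrier R"
    and "\<And>i. i \<in> {1..m} \<Longrightarrow> K (x i) = \<chi> i \<odot> x i"
  shows "K (omon x m r) = (\<Prod>i=1..m. \<chi> i ^ r i) \<odot> omon x m r"
  using assms(2,3)
proof (induction m)
  case 0
  then show ?case using assms(1) by simp
next
  case (Suc m)
  have c: "omon x m r \<in> carrier R" "x (Suc m) \<in> carrier R"
    using Suc.prems by (auto intro!: mon_closed)
  have "K (omon x m r) = (\<Prod>i=1..m. \<chi> i ^ r i) \<odot> omon x m r" using Suc by auto
  moreover have "K (x (Suc m)) = \<chi> (Suc m) \<odot> x (Suc m)" using Suc.prems by auto
  ultimately show ?case using assms(1) c by (simp add: mult_pow mult.commute)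
qed

end

section \<open>Skew derivations on quantum coordinates\<close>

lemma qnum_0 [simp]: "qnum q 0 = 0"
  by (simp add: qnum_def)

lemma qnum_inverse: "qnum (inverse q) a = qnum q a"
proof -
  have "(q powi (- a) - q powi a) / (inverse q - q) = (q powi a - q powi (- a)) / (q - inverse q)"
    by (metis minus_diff_eq minus_divide_divide)
  then show ?thesis by (simp add: qnum_def power_int_inverse power_int_minus)
qed

text \<open>The two splittings belong to the two directions: the first computes \<open>E\<close>
  when it moves index i+1 to i, the second when it moves i to i+1. The assumptions make the
  denominator q - q^(-1) nonzero.\<close>

lemma qnum_Suc:
  assumes "q \<noteq> 0" "q\<^sup>2 \<noteq> 1"
  shows "qnum q (int (Suc b)) = q * qnum q (int b) + inverse q ^ b"
    and "qnum q (int (Suc b)) = inverse q * qnum q (int b) + q ^ b"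
proof -
  have d: "q - inverse q \<noteq> 0" using assms by (auto simp: field_simps power2_eq_square)
  have p: "q powi int (Suc b) = q * q ^ b" "q powi (- int (Suc b)) = inverse q * inverse q ^ b"
    "q powi int b = q ^ b" "q powi (- int b) = inverse q ^ b"
    using power_int_of_nat[of q "Suc b"] power_int_of_nat[of q b]
    by (simp_all only: power_int_minus power_inverse) simp_all
  have frac: "A / (q - inverse q) = c * (B / (q - inverse q)) + C"
    if "A = c * B + C * (q - inverse q)" for A B C c :: complex
    using that d by (simp add: add_divide_distrib)
  show "qnum q (int (Suc b)) = q * qnum q (int b) + inverse q ^ b"
    unfolding qnum_def p by (rule frac) (simp add: algebra_simps)
  show "qnum q (int (Suc b)) = inverse q * qnum q (int b) + q ^ b"
    unfolding qnum_def p by (rule frac) (simp add: algebra_simps)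
qed

text \<open>Models a generator with comultiplication \<open>E \<otimes> K' + K \<otimes> E\<close>,
  so \<open>K'\<close> meets the right factor and \<open>K\<close> the left one.\<close>

locale skew = complex_algebra R for R :: "(complex, 'a) module" (structure) +
  fixes E K K' :: "'a \<Rightarrow> 'a"
  assumes E_lin: "linear_operator R E" and K_mult: "multiplicative K" and K'_mult: "multiplicative K'"
    and E_one: "E \<one> = \<zero>"
    and E_mult: "x \<in> carrier R \<Longrightarrow> y \<in> carrier R \<Longrightarrow> E (x \<otimes> y) = E x \<otimes> K' y \<oplus> K x \<otimes> E y"

text \<open>The parameter \<open>u\<close> is a square root of the commutation factor because
  \<open>K\<close> will scale coordinates by \<open>u\<close> and \<open>inverse u\<close>. The
  condition on \<open>u ^ 4\<close> keeps q-numbers with base \<open>u^2\<close> meaningful.\<close>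

locale coords = complex_algebra R for R :: "(complex, 'a) module" (structure) +
  fixes n :: nat and x :: "nat \<Rightarrow> 'a" and u :: complex
  assumes x_closed [simp]: "j \<in> {1..n} \<Longrightarrow> x j \<in> carrier R"
    and u_nz [simp]: "u \<noteq> 0" and u4: "u ^ 4 \<noteq> 1"
    and x_comm: "1 \<le> k \<Longrightarrow> k < j \<Longrightarrow> j \<le> n \<Longrightarrow> x k \<otimes> x j = u\<^sup>2 \<odot> (x j \<otimes> x k)"
begin

lemma x_mon_closed [simp]: "m \<le> n \<Longrightarrow> omon x m r \<in> carrier R"
  by (rule mon_closed) auto

lemma x_comm': "1 \<le> k \<Longrightarrow> k < j \<Longrightarrow> j \<le> n \<Longrightarrow> x j \<otimes> x k = (inverse u)\<^sup>2 \<odot> (x k \<otimes> x j)"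
  by (simp add: x_comm power_inverse)

lemma pow_comm: "1 \<le> k \<Longrightarrow> k < j \<Longrightarrow> j \<le> n \<Longrightarrow>
    x j [^] (b::nat) \<otimes> x k = (inverse u ^ (2 * b)) \<odot> (x k \<otimes> x j [^] b)"
proof (induction b)
  case (Suc b)
  have c: "x j \<in> carrier R" "x k \<in> carrier R" using Suc.prems by auto
  have "x j [^] Suc b \<otimes> x k = x j [^] b \<otimes> (x j \<otimes> x k)" using c by (simp add: m_assoc)
  also have "\<dots> = (inverse u)\<^sup>2 \<odot> ((x j [^] b \<otimes> x k) \<otimes> x j)"
    using c Suc.prems by (simp add: x_comm' m_assoc)
  also have "\<dots> = (inverse u ^ (2 * Suc b)) \<odot> (x k \<otimes> x j [^] Suc b)"
    using c Suc by (simp add: m_assoc power_add power2_eq_square mult_ac)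
  finally show ?case .
qed auto

lemma comm_pow: "1 \<le> k \<Longrightarrow> k < j \<Longrightarrow> j \<le> n \<Longrightarrow>
    x j \<otimes> x k [^] (b::nat) = (inverse u ^ (2 * b)) \<odot> (x k [^] b \<otimes> x j)"
proof (induction b)
  case (Suc b)
  have c: "x j \<in> carrier R" "x k \<in> carrier R" using Suc.prems by auto
  have "x j \<otimes> x k [^] Suc b = (x j \<otimes> x k [^] b) \<otimes> x k" using c by (simp add: m_assoc)
  also have "\<dots> = (inverse u ^ (2 * b)) \<odot> (x k [^] b \<otimes> (x j \<otimes> x k))"
    using c Suc by (simp add: m_assoc)
  also have "\<dots> = (inverse u ^ (2 * Suc b)) \<odot> (x k [^] Suc b \<otimes> x j)"
    using c Suc.prems by (simp add: x_comm' m_assoc power_add power2_eq_square mult_ac)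
  finally show ?case .
qed auto

text \<open>Moving a coordinate to its place costs a power of \<open>u\<close>. The lemma feeds
  spanning arguments, where the value of the scalar is irrelevant, hence the existential
  form.\<close>

lemma left_mult_mon:
  assumes j: "j \<in> {1..n}"
  shows "\<exists>c. x j \<otimes> omon x n r = c \<odot> omon x n (r(j := Suc (r j)))"
proof -
  have cm: "omon x m s \<in> carrier R" if "m \<le> n" for m s using that by simp
  have xj: "x j \<in> carrier R" using j by auto
  have A: "\<exists>c. x j \<otimes> omon x m r = c \<odot> (omon x m r \<otimes> x j)" if "m < j" for m
    using that
  proof (induction m)
    case 0
    show ?case using xj by (intro exI[of _ 1]) simp
  next
    case (Suc m)
    then obtain c where c: "x j \<otimes> omon x m r = c \<odot> (omon x m r \<otimes> x j)" by auto
    have xm: "x (Suc m) \<in> carrier R" "omon x m r \<in> carrier R" using Suc.prems j by auto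
    have "x j \<otimes> omon x (Suc m) r = (x j \<otimes> omon x m r) \<otimes> x (Suc m) [^] r (Suc m)"
      using xj xm by (simp add: m_assoc)
    also have "\<dots> = c \<odot> (omon x m r \<otimes> (x j \<otimes> x (Suc m) [^] r (Suc m)))"
      unfolding c using xj xm by (simp add: m_assoc)
    also have "\<dots> = (c * inverse u ^ (2 * r (Suc m))) \<odot> (omon x (Suc m) r \<otimes> x j)"
      using xj xm Suc.prems j by (simp add: comm_pow m_assoc)
    finally show ?case by blast
  qed
  obtain i where i: "j = Suc i" using j by (cases j) auto
  have ci: "omon x i r \<in> carrier R" using j i by auto
  have eq: "omon x i (r(j := Suc (r j))) = omon x i r" by (rule mon_cong) (auto simp: i)
  have "\<exists>c. x j \<otimes> omon x m r = c \<odot> omon x m (r(j := Suc (r j)))" if "j \<le> m" "m \<le> n" for m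
    using that
  proof (induction m rule: dec_induct)
    case base
    obtain c where c: "x j \<otimes> omon x i r = c \<odot> (omon x i r \<otimes> x j)" using A[of i] i by auto
    have "x j \<otimes> omon x j r = (x j \<otimes> omon x i r) \<otimes> x j [^] r j"
      using xj ci by (simp add: i m_assoc)
    also have "\<dots> = c \<odot> (omon x i r \<otimes> (x j \<otimes> x j [^] r j))"
      unfolding c using xj ci by (simp add: m_assoc)
    also have "x j \<otimes> x j [^] r j = x j [^] Suc (r j)" using xj by (metis nat_pow_Suc2)
    also have "omon x i r \<otimes> x j [^] Suc (r j) = omon x j (r(j := Suc (r j)))"
      using eq by (simp add: i)
    finally show ?case by blast
  next
    case (step m)
    have "m \<le> n" using step by simp
    from step.IH[OF this] obtain c where c: "x j \<otimes> omon x m r = c \<odot> omon x m (r(j := Suc (r j)))" ..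
    have xm: "x (Suc m) \<in> carrier R" using step by auto
    have "x j \<otimes> omon x (Suc m) r = (x j \<otimes> omon x m r) \<otimes> x (Suc m) [^] r (Suc m)"
      using xj xm cm[of m] step by (simp add: m_assoc)
    also have "\<dots> = c \<odot> omon x (Suc m) (r(j := Suc (r j)))"
      unfolding c using xm cm[of m] step by simp
    finally show ?case by blast
  qed
  then show ?thesis using j by auto
qed

end

locale skew_coords = coords R n x u + skew R E K K'
  for R :: "(complex, 'a) module" (structure) and n x u E K K' +
  fixes i :: nat
  assumes i: "1 \<le> i" "i < n"
    and K_x: "j \<in> {1..n} \<Longrightarrow> K (x j) = (if j = i then u else if j = i + 1 then inverse u else 1) \<odot> x j"
    and K'_x: "j \<in> {1..n} \<Longrightarrow> K' (x j) = (if j = i then inverse u else if j = i + 1 then u else 1) \<odot> x j"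
begin

text \<open>The eigenvalue of \<open>K\<close> on the ordered monomial with exponents
  \<open>r\<close>, once indices i and i+1 both occur in it; an integer power because the difference
  of exponents may be negative.\<close>

definition kap :: "(nat \<Rightarrow> nat) \<Rightarrow> complex" where
  "kap r = u powi (int (r i) - int (r (Suc i)))"

lemma u2: "u\<^sup>2 \<noteq> 0" "(u\<^sup>2)\<^sup>2 \<noteq> 1"
  using u4 by auto

lemma x_i [simp]: "x i \<in> carrier R" "x (Suc i) \<in> carrier R"
  using i by auto

lemma prod_two:
  assumes "Suc i \<le> m"
  shows "(\<Prod>j=1..m. (if j = i then v else if j = i + 1 then w else 1) ^ r j) = v ^ r i * (w ^ r (Suc i) :: complex)"
proof -
  have "(\<Prod>j=1..m. (if j = i then v else if j = i + 1 then w else 1) ^ r j) =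
    (\<Prod>j\<in>{i, Suc i}. (if j = i then v else if j = i + 1 then w else 1) ^ r j)"
    using assms i by (intro prod.mono_neutral_right) auto
  then show ?thesis by simp
qed

lemma K_mon:
  assumes "Suc i \<le> m" "m \<le> n" shows "K (omon x m r) = kap r \<odot> omon x m r"
proof -
  have "K (omon x m r) = (\<Prod>j=1..m. (if j = i then u else if j = i + 1 then inverse u else 1) ^ r j) \<odot> omon x m r"
    using assms by (intro mult_mon K_mult K_x) auto
  then show ?thesis
    unfolding prod_two[OF assms(1)] kap_def by (simp add: power_int_diff divide_inverse power_inverse)
qed

lemma K'_mon:
  assumes "Suc i \<le> m" "m \<le> n" shows "K' (omon x m r) = inverse (kap r) \<odot> omon x m r"
proof -
  have "K' (omon x m r) = (\<Prod>j=1..m. (if j = i then inverse u else if j = i + 1 then u else 1) ^ r j) \<odot> omon x m r"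
    using assms by (intro mult_mon K'_mult K'_x) auto
  then show ?thesis
    unfolding prod_two[OF assms(1)] kap_def by (simp add: power_int_diff divide_inverse power_inverse mult.commute)
qed

lemma E_pow_zero:
  assumes "y \<in> carrier R" "E y = \<zero>" "K y = a \<odot> y" "K' y = b \<odot> y"
  shows "E (y [^] (k::nat)) = \<zero>"
  using assms by (induction k) (simp_all add: E_one E_mult mult_pow[OF K_mult] mult_pow[OF K'_mult])

lemma E_mon_below:
  assumes "\<And>j. j \<in> {1..n} \<Longrightarrow> j < i \<Longrightarrow> E (x j) = \<zero>" "m < i"
  shows "E (omon x m r) = \<zero>"
  using assms(2)
proof (induction m)
  case (Suc m)
  have c: "x (Suc m) \<in> carrier R" "omon x m r \<in> carrier R" using Suc i by auto
  have "E (x (Suc m) [^] r (Suc m)) = \<zero>"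
    by (rule E_pow_zero[OF _ _ K_x K'_x]) (use assms(1) Suc i c in auto)
  then show ?case using Suc c K_mult K'_mult by (simp add: E_mult)
qed (simp add: E_one)

text \<open>Coordinates beyond i+1 are killed by \<open>E\<close> and fixed by \<open>K'\<close>, so
  as right factors they are carried along unchanged. The calculation thus reduces to the coordinates
  up to i+1.\<close>

lemma E_mon_extend:
  assumes "\<And>j. j \<in> {1..n} \<Longrightarrow> Suc i < j \<Longrightarrow> E (x j) = \<zero>"
    and "E (omon x (Suc i) r) = c \<odot> omon x (Suc i) s" "\<And>j. Suc i < j \<Longrightarrow> s j = r j"
    and "Suc i \<le> m" "m \<le> n"
  shows "E (omon x m r) = c \<odot> omon x m s"
  using assms(4,5)
proof (induction m rule: dec_induct)
  case base
  show ?case by (rule assms(2))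
next
  case (step m)
  have c: "x (Suc m) \<in> carrier R" using step by auto
  have "E (x (Suc m) [^] r (Suc m)) = \<zero>"
    by (rule E_pow_zero[OF _ _ K_x K'_x]) (use assms(1) step i c in auto)
  moreover have "K' (x (Suc m)) = x (Suc m)" using K'_x[of "Suc m"] step c by simp
  ultimately show ?case using step c K_mult K'_mult assms(3)
    by (simp add: E_mult mult_pow)
qed

end

section \<open>The two-coordinate calculation and its closed forms on monomials\<close>

context skew_coords
begin

lemma mult_mon_below:
  assumes "multiplicative H" "\<And>j. j \<in> {1..n} \<Longrightarrow> j < i \<Longrightarrow> H (x j) = x j" "m < i"
  shows "H (omon x m r) = omon x m r"
proof -
  have "H (omon x m r) = (\<Prod>j=1..m. (1::complex) ^ r j) \<odot> omon x m r"
    using assms i by (intro mult_mon[where \<chi> = "\<lambda>_. 1"]) auto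
  then show ?thesis using assms(3) i by simp
qed

lemma mon_pair:
  "omon x (Suc i) s = omon x (i - 1) s \<otimes> x i [^] s i \<otimes> x (Suc i) [^] s (Suc i)"
  using i by (cases i) auto

text \<open>The lower coordinates are killed by \<open>E\<close> and fixed by \<open>K\<close> and
  \<open>K'\<close>, so \<open>E\<close> passes over them. Of the two weights,
  \<open>u ^ r (Suc i)\<close> is \<open>K'\<close> on the power of \<open>x (Suc i)\<close> and
  \<open>u ^ r i\<close> is \<open>K\<close> on the power of \<open>x i\<close>.\<close>

lemma E_mon_pair:
  assumes "\<And>j. j \<in> {1..n} \<Longrightarrow> j < i \<Longrightarrow> E (x j) = \<zero>"
  shows "E (omon x (Suc i) r) = omon x (i - 1) r \<otimes>
    (u ^ r (Suc i) \<odot> (E (x i [^] r i) \<otimes> x (Suc i) [^] r (Suc i)) \<oplus>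
     u ^ r i \<odot> (x i [^] r i \<otimes> E (x (Suc i) [^] r (Suc i))))"
proof -
  let ?P = "omon x (i - 1) r"
  have P: "?P \<in> carrier R" "E ?P = \<zero>" "K ?P = ?P" "K' ?P = ?P"
    using i K_x K'_x K_mult K'_mult by (auto intro!: E_mon_below assms mult_mon_below)
  have X: "K (x i) = u \<odot> x i" "K' (x (Suc i)) = u \<odot> x (Suc i)"
    using K_x[of i] K'_x[of "Suc i"] i by auto
  have c: "K' (x i) \<in> carrier R" "E (x i [^] r i) \<in> carrier R" "E (x (Suc i) [^] r (Suc i)) \<in> carrier R"
    using K'_mult E_lin by simp_all
  have "E (?P \<otimes> x i [^] r i) = ?P \<otimes> E (x i [^] r i)"
    using P c K'_mult by (simp add: E_mult mult_pow)
  moreover have "K (?P \<otimes> x i [^] r i) = u ^ r i \<odot> (?P \<otimes> x i [^] r i)"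
    using P K_mult X by (simp add: mult_pow)
  ultimately show ?thesis unfolding mon_pair
    using P X c K_mult K'_mult by (simp add: E_mult mult_pow m_assoc r_distr)
qed

lemma powi_one_minus:
  "u powi (1 - int b) = u / u ^ b" "u powi (1 - int (Suc b)) = 1 / u ^ b"
proof -
  have *: "u powi (1 - int b) = u / u ^ b" for b
    using power_int_diff[of u 1 "int b"] by simp
  show "u powi (1 - int b) = u / u ^ b" "u powi (1 - int (Suc b)) = 1 / u ^ b"
    unfolding * by simp_all
qed

text \<open>The induction step for the coefficient of \<open>E\<close> on the b-th power of
  \<open>x (Suc i)\<close>. The factor \<open>u\<close> is \<open>K'\<close> on the last factor; in
  the second summand u^(-b) comes from \<open>K\<close> and u^(-2b) from moving the new
  \<open>x i\<close> to the front.\<close>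

lemma scalar_down:
  "c * u powi (1 - int (Suc b)) * qnum (u\<^sup>2) (int (Suc b)) =
    u * (c * u powi (1 - int b) * qnum (u\<^sup>2) (int b)) + inverse u ^ b * c * inverse u ^ (2 * b)"
  unfolding powi_one_minus qnum_Suc(1)[OF u2]
  by (simp add: field_simps power_mult power2_eq_square power_mult_distrib)

text \<open>The counterpart for powers of \<open>x i\<close>: u^(-1) is \<open>K'\<close> on the
  last factor and u^(-2) moves that factor left of \<open>x (Suc i)\<close>. The second summand
  carries only \<open>K\<close>, since the new \<open>x (Suc i)\<close> already stands at the
  end.\<close>

lemma scalar_up:
  "c * u powi (1 - int (Suc a)) * qnum (u\<^sup>2) (int (Suc a)) =
    inverse u * (c * u powi (1 - int a) * qnum (u\<^sup>2) (int a) * (inverse u)\<^sup>2) + u ^ a * c"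
  unfolding powi_one_minus qnum_Suc(2)[OF u2]
  by (simp add: field_simps power2_eq_square power_mult_distrib)

lemma E_pow_down:
  assumes "E (x (Suc i)) = c \<odot> x i"
  shows "E (x (Suc i) [^] b) = (c * u powi (1 - int b) * qnum (u\<^sup>2) (int b)) \<odot> (x i \<otimes> x (Suc i) [^] (b - 1))"
proof (induction b)
  case 0
  show ?case by (simp add: E_one)
next
  case (Suc b)
  have X: "K (x (Suc i)) = inverse u \<odot> x (Suc i)" "K' (x (Suc i)) = u \<odot> x (Suc i)"
    using K_x[of "Suc i"] K'_x[of "Suc i"] i by auto
  let ?m = "x i \<otimes> x (Suc i) [^] b"
  let ?d = "c * u powi (1 - int b) * qnum (u\<^sup>2) (int b)"
  \<comment> \<open>For b = 0 the exponent b - 1 truncates and the two monomials differ, but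
    \<open>?d\<close> then contains [0] = 0.\<close>
  have eq: "?d \<odot> (x i \<otimes> x (Suc i) [^] (b - 1)) \<otimes> x (Suc i) = ?d \<odot> ?m"
    by (cases b) (simp_all add: m_assoc)
  have com: "x (Suc i) [^] b \<otimes> x i = inverse u ^ (2 * b) \<odot> ?m"
    using pow_comm[of i "Suc i" b] i by simp
  have "E (x (Suc i) [^] Suc b) = u \<odot> (?d \<odot> (x i \<otimes> x (Suc i) [^] (b - 1)) \<otimes> x (Suc i)) \<oplus>
      (inverse u ^ b * c) \<odot> (x (Suc i) [^] b \<otimes> x i)"
    using K_mult by (simp add: E_mult mult_pow X Suc assms mult.commute)
  also have "\<dots> = (u * ?d) \<odot> ?m \<oplus> (inverse u ^ b * c * inverse u ^ (2 * b)) \<odot> ?m"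
    unfolding eq com by simp
  also have "\<dots> = (c * u powi (1 - int (Suc b)) * qnum (u\<^sup>2) (int (Suc b))) \<odot> ?m"
    by (rule smult_sum_cong) (simp_all only: scalar_down m_closed x_i nat_pow_closed)
  finally show ?case by simp
qed

lemma E_pow_up:
  assumes "E (x i) = c \<odot> x (Suc i)"
  shows "E (x i [^] a) = (c * u powi (1 - int a) * qnum (u\<^sup>2) (int a)) \<odot> (x i [^] (a - 1) \<otimes> x (Suc i))"
proof (induction a)
  case 0
  show ?case by (simp add: E_one)
next
  case (Suc a)
  have X: "K (x i) = u \<odot> x i" "K' (x i) = inverse u \<odot> x i"
    using K_x[of i] K'_x[of i] i by auto
  let ?m = "x i [^] a \<otimes> x (Suc i)"
  let ?d = "c * u powi (1 - int a) * qnum (u\<^sup>2) (int a)"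
  have com: "x (Suc i) \<otimes> x i = (inverse u)\<^sup>2 \<odot> (x i \<otimes> x (Suc i))"
    using x_comm'[of i "Suc i"] i by simp
  have eq: "?d \<odot> (x i [^] (a - 1) \<otimes> x (Suc i)) \<otimes> x i = (?d * (inverse u)\<^sup>2) \<odot> ?m"
  proof (cases a)
    case (Suc a')
    have "x i [^] a' \<otimes> x (Suc i) \<otimes> x i = (inverse u)\<^sup>2 \<odot> (x i [^] Suc a' \<otimes> x (Suc i))"
      by (simp add: m_assoc com)
    then show ?thesis using Suc by simp
  qed simp
  have "E (x i [^] Suc a) = inverse u \<odot> (?d \<odot> (x i [^] (a - 1) \<otimes> x (Suc i)) \<otimes> x i) \<oplus>
      (u ^ a * c) \<odot> ?m"
    using K_mult by (simp add: E_mult mult_pow X Suc assms mult.commute)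
  also have "\<dots> = (inverse u * (?d * (inverse u)\<^sup>2)) \<odot> ?m \<oplus> (u ^ a * c) \<odot> ?m"
    unfolding eq by simp
  also have "\<dots> = (c * u powi (1 - int (Suc a)) * qnum (u\<^sup>2) (int (Suc a))) \<odot> ?m"
    by (rule smult_sum_cong) (simp_all only: scalar_up m_closed x_i nat_pow_closed)
  finally show ?case by simp
qed

text \<open>
  The truncated subtraction below is harmless: whenever it truncates, the coefficient of the
  monomial contains the factor \<open>qnum (u\<^sup>2) 0 = 0\<close>.
\<close>

definition down :: "(nat \<Rightarrow> nat) \<Rightarrow> nat \<Rightarrow> nat" where
  "down r = r(i := Suc (r i), Suc i := r (Suc i) - 1)"

definition up :: "(nat \<Rightarrow> nat) \<Rightarrow> nat \<Rightarrow> nat" where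
  "up r = r(i := r i - 1, Suc i := Suc (r (Suc i)))"

text \<open>The new \<open>x i\<close> is produced at the left end of the power of
  \<open>x (Suc i)\<close> and merges with the power of \<open>x i\<close> without reordering. The
  power of u is therefore just the product of u^(r i) from \<open>K\<close> and u^(1 - r (Suc i))
  from the power.\<close>

lemma E_mon_down:
  assumes "\<And>j. j \<in> {1..n} \<Longrightarrow> E (x j) = (if j = i + 1 then c \<odot> x i else \<zero>)"
  shows "E (omon x n r) = (c * u powi (int (r i) - int (r (Suc i)) + 1) * qnum (u\<^sup>2) (int (r (Suc i)))) \<odot> omon x n (down r)"
    (is "_ = ?c \<odot> _")
proof (rule E_mon_extend)
  let ?P = "omon x (i - 1) r"
  have P: "?P \<in> carrier R" using i by simp
  have eq: "omon x (i - 1) (down r) = ?P" by (rule mon_cong) (use i in \<open>auto simp: down_def\<close>)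
  have Z: "E (x i [^] r i) = \<zero>"
    by (rule E_pow_zero[OF _ _ K_x K'_x]) (use assms[of i] i in auto)
  have "E (omon x (Suc i) r) = ?P \<otimes> (u ^ r i \<odot> (x i [^] r i \<otimes> E (x (Suc i) [^] r (Suc i))))"
    using E_mon_pair[of r] assms i P E_lin by (simp add: Z)
  also have "\<dots> = (u ^ r i * (c * u powi (1 - int (r (Suc i))) * qnum (u\<^sup>2) (int (r (Suc i))))) \<odot>
     (?P \<otimes> (x i [^] r i \<otimes> (x i \<otimes> x (Suc i) [^] (r (Suc i) - 1))))"
    using assms[of "Suc i"] i P by (simp add: E_pow_down)
  also have "?P \<otimes> (x i [^] r i \<otimes> (x i \<otimes> x (Suc i) [^] (r (Suc i) - 1))) = omon x (Suc i) (down r)"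
    unfolding mon_pair[of "down r"] eq using P nat_pow_mult[OF x_i(1), of "r i" 1]
    by (simp add: m_assoc) (simp add: down_def m_assoc)
  also have "u ^ r i * (c * u powi (1 - int (r (Suc i))) * qnum (u\<^sup>2) (int (r (Suc i)))) = ?c"
    by (simp add: power_int_diff power_int_add)
  finally show "E (omon x (Suc i) r) = ?c \<odot> omon x (Suc i) (down r)" .
qed (use assms i in \<open>auto simp: down_def\<close>)

lemma E_mon_up:
  assumes "\<And>j. j \<in> {1..n} \<Longrightarrow> E (x j) = (if j = i then c \<odot> x (i + 1) else \<zero>)"
  shows "E (omon x n r) = (c * u powi (int (r (Suc i)) - int (r i) + 1) * qnum (u\<^sup>2) (int (r i))) \<odot> omon x n (up r)"
    (is "_ = ?c \<odot> _")
proof (rule E_mon_extend)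
  let ?P = "omon x (i - 1) r"
  have P: "?P \<in> carrier R" using i by simp
  have eq: "omon x (i - 1) (up r) = ?P" by (rule mon_cong) (use i in \<open>auto simp: up_def\<close>)
  have Z: "E (x (Suc i) [^] r (Suc i)) = \<zero>"
    by (rule E_pow_zero[OF _ _ K_x K'_x]) (use assms[of "Suc i"] i in auto)
  have "E (omon x (Suc i) r) = ?P \<otimes> (u ^ r (Suc i) \<odot> (E (x i [^] r i) \<otimes> x (Suc i) [^] r (Suc i)))"
    using E_mon_pair[of r] assms i P E_lin by (simp add: Z)
  also have "\<dots> = (u ^ r (Suc i) * (c * u powi (1 - int (r i)) * qnum (u\<^sup>2) (int (r i)))) \<odot>
     (?P \<otimes> ((x i [^] (r i - 1) \<otimes> x (Suc i)) \<otimes> x (Suc i) [^] r (Suc i)))"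
    using assms[of i] i P by (simp add: E_pow_up)
  also have "?P \<otimes> ((x i [^] (r i - 1) \<otimes> x (Suc i)) \<otimes> x (Suc i) [^] r (Suc i)) = omon x (Suc i) (up r)"
    using P x_i nat_pow_Suc2[OF x_i(2), of "r (Suc i)"]
    
    unfolding mon_pair[of "up r"] eq by (simp add: m_assoc) (simp add: up_def m_assoc)
  also have "u ^ r (Suc i) * (c * u powi (1 - int (r i)) * qnum (u\<^sup>2) (int (r i))) = ?c"
    by (simp add: power_int_diff power_int_add)
  finally show "E (omon x (Suc i) r) = ?c \<odot> omon x (Suc i) (up r)" .
qed (use assms i in \<open>auto simp: up_def\<close>)

end

section \<open>Commutation of skew derivations with the partial derivatives\<close>

definition tail :: "nat \<Rightarrow> nat \<Rightarrow> (nat \<Rightarrow> nat) \<Rightarrow> nat" where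
  "tail n j r = (\<Sum>k\<in>{j+1..n}. r k)"

text \<open>Stated with a sum on each side so that no natural-number subtraction occurs.\<close>

lemma tail_upd:
  "tail n j (r(k := v)) + (if j < k \<and> k \<le> n then r k else 0) =
    tail n j r + (if j < k \<and> k \<le> n then v else 0)"
proof (cases "j < k \<and> k \<le> n")
  case True
  have "(\<Sum>l\<in>{j+1..n}. (r(k := v)) l) = v + (\<Sum>l\<in>{j+1..n}-{k}. r l)"
    using True by (subst sum.remove[of _ k]) (auto intro!: sum.cong)
  moreover have "(\<Sum>l\<in>{j+1..n}. r l) = r k + (\<Sum>l\<in>{j+1..n}-{k}. r l)"
    using True by (subst sum.remove[of _ k]) auto
  ultimately show ?thesis using True by (simp add: tail_def)
next
  case False
  then show ?thesis by (auto simp: tail_def intro!: sum.cong)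
qed

lemma tail_Suc: "j < n \<Longrightarrow> tail n j r = r (Suc j) + tail n (Suc j) r"
  unfolding tail_def by (simp add: sum.atLeast_Suc_atMost)

text \<open>Here \<open>x\<close> is the family standing on the left in the ordering on which
  \<open>D\<close> is prescribed, and \<open>y\<close> is the other family. The instances are z
  before w with parameter \<open>h\<close> and w before z with parameter
  \<open>inverse h\<close>.\<close>

locale coords_diff = coords R n x u for R :: "(complex, 'a) module" (structure) and n x u +
  fixes y :: "nat \<Rightarrow> 'a" and D :: "nat \<Rightarrow> 'a \<Rightarrow> 'a"
  assumes y_closed [simp]: "j \<in> {1..n} \<Longrightarrow> y j \<in> carrier R"
    and D_lin: "j \<in> {1..n} \<Longrightarrow> linear_operator R (D j)"
    and D_mon: "j \<in> {1..n} \<Longrightarrow> D j (omon x n r \<otimes> omon y n s) =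
      ((u\<^sup>2) ^ tail n j r * qnum (u\<^sup>2) (int (r j))) \<odot> (omon x n (r(j := r j - 1)) \<otimes> omon y n s)"
    and spanning: "p \<in> carrier R \<Longrightarrow> p \<in> lspan {omon x n r \<otimes> omon y n s | r s. True}"
begin

lemma y_mon_closed [simp]: "omon y n s \<in> carrier R"
  by (rule mon_closed) auto

lemma eq_on_monomials:
  assumes "linear_operator R S" "linear_operator R T"
    and "\<And>r s. S (omon x n r \<otimes> omon y n s) = T (omon x n r \<otimes> omon y n s)" "p \<in> carrier R"
  shows "S p = T p"
  by (rule lin_eq_lspan[OF _ assms(1,2) _ spanning[OF assms(4)]]) (auto simp: assms(3))

text \<open>Removing one factor \<open>x j\<close> costs \<open>H\<close> one eigenvalue
  \<open>\<chi> j\<close>; the eigenvalue on the \<open>y\<close> part is the same on both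
  sides.\<close>

lemma D_mult:
  assumes H: "multiplicative H" and Hx: "\<And>k. k \<in> {1..n} \<Longrightarrow> H (x k) = \<chi> k \<odot> x k"
    and Hy: "\<And>s. \<exists>b. H (omon y n s) = b \<odot> omon y n s"
    and j: "j \<in> {1..n}" and p: "p \<in> carrier R"
  shows "D j (H p) = \<chi> j \<odot> H (D j p)"
proof (rule eq_on_monomials[OF _ _ _ p])
  show "linear_operator R (\<lambda>p. D j (H p))" "linear_operator R (\<lambda>p. \<chi> j \<odot> H (D j p))"
    by (rule lin_comp[OF D_lin[OF j] multD(1)[OF H]] lin_scale[OF lin_comp[OF multD(1)[OF H] D_lin[OF j]]])+
  fix r s :: "nat \<Rightarrow> nat"
  let ?r = "r(j := r j - 1)"
  let ?d = "(u\<^sup>2) ^ tail n j r * qnum (u\<^sup>2) (int (r j))"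
  obtain b where b: "H (omon y n s) = b \<odot> omon y n s" using Hy by blast
  define P where "P r = (\<Prod>k=1..n. \<chi> k ^ r k)" for r
  have Hm: "H (omon x n r) = P r \<odot> omon x n r" for r
    unfolding P_def by (rule mult_mon[OF H x_closed Hx])
  \<comment> \<open>For \<open>r j = 0\<close> no factor is removed, but then \<open>?d\<close>
    contains [0] = 0.\<close>
  have eq: "b * (?d * P r) = b * (\<chi> j * (?d * P ?r))"
  proof (cases "r j")
    case (Suc a)
    have "(\<Prod>k\<in>{1..n}-{j}. \<chi> k ^ r k) = (\<Prod>k\<in>{1..n}-{j}. \<chi> k ^ ?r k)"
      by (rule prod.cong) auto
    then have "(\<Prod>k=1..n. \<chi> k ^ r k) = \<chi> j * (\<Prod>k=1..n. \<chi> k ^ ?r k)"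
      using j Suc by (simp add: prod.remove[of _ j])
    then show ?thesis by (simp add: P_def)
  qed simp
  have "D j (H (omon x n r \<otimes> omon y n s)) = (b * (?d * P r)) \<odot> (omon x n ?r \<otimes> omon y n s)"
    using H by (simp add: Hm b lin_smult[OF D_lin[OF j]] D_mon[OF j] mult_ac)
  also have "\<dots> = \<chi> j \<odot> H (D j (omon x n r \<otimes> omon y n s))"
    unfolding eq using H by (simp add: Hm b lin_smult[of H] D_mon[OF j] mult_ac)
  finally show "D j (H (omon x n r \<otimes> omon y n s)) = \<chi> j \<odot> H (D j (omon x n r \<otimes> omon y n s))" .
qed

end

locale skew_diff = coords_diff R n x u y D + skew_coords R n x u E K K' i
  for R :: "(complex, 'a) module" (structure) and n x u y D E K K' i +
  assumes E_y: "\<exists>b t. E (omon y n s) = b \<odot> omon y n t"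
    and K'_y: "\<exists>b. K' (omon y n s) = b \<odot> omon y n s"
begin

abbreviation dcoef :: "nat \<Rightarrow> (nat \<Rightarrow> nat) \<Rightarrow> complex" where
  "dcoef j r \<equiv> (u\<^sup>2) ^ tail n j r * qnum (u\<^sup>2) (int (r j))"

text \<open>In E(xy) = E(x) K'(y) + K(x) E(y) the derivative ignores the \<open>y\<close> factor.
  The second summand dictates \<open>v\<close>, the change of the \<open>K\<close>-eigenvalue when
  one \<open>x j\<close> is removed. The first summand and the \<open>K'\<close> term share the
  eigenvalue of \<open>K'\<close> on \<open>y\<close>; factoring it out leaves the identity
  \<open>first\<close> between \<open>x\<close>-monomials alone.\<close>

lemma D_E_aux:
  assumes E_x: "\<And>r. E (omon x n r) = al r \<odot> omon x n (g r)"
    and j: "j \<in> {1..n}" and l: "l \<in> {1..n}"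
    and first: "\<And>r. (al r * dcoef j (g r)) \<odot> omon x n ((g r)(j := g r j - 1)) =
      (v * (dcoef j r * al (r(j := r j - 1)))) \<odot> omon x n (g (r(j := r j - 1))) \<oplus>
      (\<mu> * (inverse (kap r) * dcoef l r)) \<odot> omon x n (r(l := r l - 1))"
    and v: "v = (if j = i then u else if j = i + 1 then inverse u else 1)"
    and p: "p \<in> carrier R"
  shows "D j (E p) = v \<odot> E (D j p) \<oplus> \<mu> \<odot> D l (K' p)"
proof (rule eq_on_monomials[OF _ _ _ p])
  show "linear_operator R (\<lambda>p. D j (E p))" "linear_operator R (\<lambda>p. v \<odot> E (D j p) \<oplus> \<mu> \<odot> D l (K' p))"
    by (rule lin_comp[OF D_lin[OF j] E_lin] lin_plus[OF lin_scale[OF lin_comp[OF E_lin D_lin[OF j]]]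
      lin_scale[OF lin_comp[OF D_lin[OF l] multD(1)[OF K'_mult]]]])+
  fix r s :: "nat \<Rightarrow> nat"
  let ?r = "r(j := r j - 1)"
  obtain b t where b: "E (omon y n s) = b \<odot> omon y n t" using E_y by blast
  obtain \<kappa> where \<kappa>: "K' (omon y n s) = \<kappa> \<odot> omon y n s" using K'_y by blast
  have Kx: "K (omon x n r) = kap r \<odot> omon x n r" "K' (omon x n r) = inverse (kap r) \<odot> omon x n r" for r
    using i by (auto intro!: K_mon K'_mon)
  have kv: "dcoef j r * kap r = v * (dcoef j r * kap ?r)"
  proof (cases "r j")
    case (Suc a)
    then show ?thesis using v by (auto simp: kap_def power_int_diff power_int_add field_simps)
  qed simp
  have EM: "E (omon x n r \<otimes> omon y n s) = (al r * \<kappa>) \<odot> (omon x n (g r) \<otimes> omon y n s)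
      \<oplus> (kap r * b) \<odot> (omon x n r \<otimes> omon y n t)" for r
    by (simp add: E_mult E_x b \<kappa> Kx mult_ac)
  have "D j (E (omon x n r \<otimes> omon y n s)) =
      \<kappa> \<odot> ((al r * dcoef j (g r)) \<odot> omon x n ((g r)(j := g r j - 1)) \<otimes> omon y n s) \<oplus>
      (b * (dcoef j r * kap r)) \<odot> (omon x n ?r \<otimes> omon y n t)"
    unfolding EM using j by (simp add: lin_add[OF D_lin] lin_smult[OF D_lin] D_mon mult_ac)
  also have "\<dots> = v \<odot> E (D j (omon x n r \<otimes> omon y n s)) \<oplus> \<mu> \<odot> D l (K' (omon x n r \<otimes> omon y n s))"
    unfolding first kv using j l K'_mult
    by (simp add: lin_smult[OF D_lin] lin_smult[OF E_lin] D_mon EM Kx \<kappa> l_distr smult_add mult_ac a_ac)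
  finally show "D j (E (omon x n r \<otimes> omon y n s)) =
    v \<odot> E (D j (omon x n r \<otimes> omon y n s)) \<oplus> \<mu> \<odot> D l (K' (omon x n r \<otimes> omon y n s))" .
qed

text \<open>The indices beyond j include both of i and i+1 or neither, except for j = i, where only
  i+1 is counted. The hypothesis guarantees that there is a unit to move.\<close>

lemma tail_down: "r (Suc i) \<noteq> 0 \<Longrightarrow> tail n j (down r) = (if j = i then tail n j r - 1 else tail n j r)"
  using i tail_upd[of n j "r(i := Suc (r i))" "Suc i" "r (Suc i) - 1"] tail_upd[of n j r i "Suc (r i)"]
  by (cases "j = i") (auto simp: down_def split: if_splits)

lemma tail_up: "r i \<noteq> 0 \<Longrightarrow> tail n j (up r) = (if j = i then tail n j r + 1 else tail n j r)"
  using i tail_upd[of n j "r(i := r i - 1)" "Suc i" "Suc (r (Suc i))"] tail_upd[of n j r i "r i - 1"]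
  by (cases "j = i") (auto simp: up_def split: if_splits)

text \<open>For j = i the derivative meets the exponent r i + 1, and [r i + 1] = u^2 [r i] + u^(-2 r
  i). The u^2 offsets the shortened tail and yields \<open>u \<odot> E (D j p)\<close>; the pure
  power yields the cross term, whose remaining powers of u are the eigenvalue of \<open>K'\<close>
  and the tail weight of \<open>D (i + 1)\<close>.\<close>

lemma D_down:
  assumes "\<And>j. j \<in> {1..n} \<Longrightarrow> E (x j) = (if j = i + 1 then c \<odot> x i else \<zero>)"
    and j: "j \<in> {1..n}" and p: "p \<in> carrier R"
  shows "D j (E p) = (if j = i then u \<odot> E (D j p) \<oplus> (c / u) \<odot> D (i + 1) (K' p)
    else if j = i + 1 then inverse u \<odot> E (D j p) else E (D j p))"
proof -
  note Ed = E_mon_down[OF assms(1)]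
  have cl: "K' p \<in> carrier R" "E (D j p) \<in> carrier R"
    using K'_mult E_lin D_lin[OF j] p by auto
  consider "j = i" | "j = Suc i" | "j \<noteq> i" "j \<noteq> Suc i" by blast
  then show ?thesis
  proof cases
    case 1
    have "D j (E p) = u \<odot> E (D j p) \<oplus> (c / u) \<odot> D (Suc i) (K' p)"
    proof (rule D_E_aux[OF Ed j _ _ _ p])
      fix r :: "nat \<Rightarrow> nat"
      let ?m = "omon x n (r(Suc i := r (Suc i) - 1))"
      have t: "tail n i r = r (Suc i) + tail n (Suc i) r" using i by (simp add: tail_Suc)
      show "(c * u powi (int (r i) - int (r (Suc i)) + 1) * qnum (u\<^sup>2) (int (r (Suc i))) * dcoef j (down r)) \<odot>
          omon x n ((down r)(j := down r j - 1)) =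
        (u * (dcoef j r * (c * u powi (int ((r(j := r j - 1)) i) - int ((r(j := r j - 1)) (Suc i)) + 1) *
          qnum (u\<^sup>2) (int ((r(j := r j - 1)) (Suc i)))))) \<odot> omon x n (down (r(j := r j - 1))) \<oplus>
        (c / u * (inverse (kap r) * dcoef (Suc i) r)) \<odot> ?m" (is "?a \<odot> ?m1 = ?b \<odot> ?m2 \<oplus> ?c \<odot> ?m")
      proof -
        \<comment> \<open>One \<open>x i\<close> is gained under \<open>E\<close> and lost under the
          derivative; what remains is the loss of one \<open>x (Suc i)\<close>, as under
          \<open>D (Suc i)\<close>.\<close>
        have 11: "?m1 = ?m" using 1 by (simp add: down_def fun_upd_twist)
        \<comment> \<open>For \<open>r i = 0\<close> the monomials may differ, but the coefficient
          \<open>?b\<close> contains [0] = 0.\<close>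
        have 2: "?b \<odot> ?m2 = ?b \<odot> ?m"
        proof (cases "r i")
          case (Suc a)
          then have "down (r(j := r j - 1)) = r(Suc i := r (Suc i) - 1)"
            using 1 by (auto simp: down_def fun_eq_iff)
          then show ?thesis by simp
        qed (use 1 in simp)
        have 3: "?b + ?c = ?a"
        proof (cases "r (Suc i)")
          case (Suc b)
          have q: "qnum (u\<^sup>2) (int (Suc (r i))) = u\<^sup>2 * qnum (u\<^sup>2) (int (r i)) + inverse (u\<^sup>2) ^ r i"
            by (rule qnum_Suc[OF u2])
          have dr: "down r i = Suc (r i)" by (simp add: down_def)
          have dc: "dcoef j (down r) = (u\<^sup>2) ^ (b + tail n (Suc i) r) * (u\<^sup>2 * qnum (u\<^sup>2) (int (r i)) + inverse (u\<^sup>2) ^ r i)"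
            using 1 Suc t q tail_down[of r i] dr by simp
          show ?thesis unfolding dc
            using 1 Suc t
            by (cases "r i") (simp_all add: kap_def power_int_diff power_int_add power_int_minus power_add field_simps power2_eq_square power_mult_distrib)
        qed (use 1 in simp)
        show ?thesis unfolding 11 2 using 3 i by (subst smult_sum_cong[OF _ 3[symmetric]]) auto
      qed
    qed (use 1 i in auto)
    then show ?thesis using 1 by simp
  next
    case 2
    \<comment> \<open>There is no cross term at this index: its weight is 0, and j merely fills the
      place of \<open>l\<close>.\<close>
    have "D j (E p) = inverse u \<odot> E (D j p) \<oplus> 0 \<odot> D j (K' p)"
    proof (rule D_E_aux[OF Ed j j _ _ p])
      fix r :: "nat \<Rightarrow> nat"
      let ?r = "r(j := r j - 1)"
      let ?al = "\<lambda>r. c * u powi (int (r i) - int (r (Suc i)) + 1) * qnum (u\<^sup>2) (int (r (Suc i)))"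
      have "(?al r * dcoef j (down r)) \<odot> omon x n ((down r)(j := down r j - 1)) =
        (inverse u * (dcoef j r * ?al ?r)) \<odot> omon x n (down ?r)"
      proof (cases "r (Suc i)")
        case (Suc b)
        have "(down r)(j := down r j - 1) = down ?r" using 2 by (auto simp: down_def fun_eq_iff)
        moreover have "dcoef j (down r) = (u\<^sup>2) ^ tail n (Suc i) r * qnum (u\<^sup>2) (int b)"
          using 2 Suc tail_down[of r "Suc i"] by (simp add: down_def)
        moreover have "?al r * ((u\<^sup>2) ^ tail n (Suc i) r * qnum (u\<^sup>2) (int b)) = inverse u * (dcoef j r * ?al ?r)"
          using 2 Suc by (simp add: power_int_diff power_int_add field_simps)
        ultimately show ?thesis by (simp only:)
      qed (use 2 in simp)
      then show "(?al r * dcoef j (down r)) \<odot> omon x n ((down r)(j := down r j - 1)) =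
        (inverse u * (dcoef j r * ?al ?r)) \<odot> omon x n (down ?r) \<oplus>
        (0 * (inverse (kap r) * dcoef j r)) \<odot> omon x n ?r" by simp
    qed (use 2 in auto)
    then show ?thesis using 2 cl D_lin j by simp
  next
    case 3
    have "D j (E p) = 1 \<odot> E (D j p) \<oplus> 0 \<odot> D j (K' p)"
    proof (rule D_E_aux[OF Ed j j _ _ p])
      fix r :: "nat \<Rightarrow> nat"
      let ?r = "r(j := r j - 1)"
      let ?al = "\<lambda>r. c * u powi (int (r i) - int (r (Suc i)) + 1) * qnum (u\<^sup>2) (int (r (Suc i)))"
      have "(down r)(j := down r j - 1) = down ?r" using 3 by (auto simp: down_def fun_eq_iff)
      moreover have "?al r * dcoef j (down r) = 1 * (dcoef j r * ?al ?r)"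
      proof (cases "r (Suc i)")
        case (Suc b)
        then show ?thesis using 3 tail_down[of r j] by (simp add: down_def)
      qed (use 3 in simp)
      ultimately have "(?al r * dcoef j (down r)) \<odot> omon x n ((down r)(j := down r j - 1)) =
        (1 * (dcoef j r * ?al ?r)) \<odot> omon x n (down ?r)" by (simp only:)
      then show "(?al r * dcoef j (down r)) \<odot> omon x n ((down r)(j := down r j - 1)) =
        (1 * (dcoef j r * ?al ?r)) \<odot> omon x n (down ?r) \<oplus>
        (0 * (inverse (kap r) * dcoef j r)) \<odot> omon x n ?r" by simp
    qed (use 3 in auto)
    then show ?thesis using 3 cl D_lin j by simp
  qed
qed

text \<open>Now the derivative at i+1 meets a raised exponent, and [a+1] = u^(-2) [a] + u^(2a) with
  a = r (Suc i). The power u^(2a) together with the tail beyond i+1 is exactly the tail weight of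
  \<open>D i\<close>, and \<open>K'\<close> accounts for the rest up to
  \<open>c * u\<close>.\<close>

lemma D_up:
  assumes "\<And>j. j \<in> {1..n} \<Longrightarrow> E (x j) = (if j = i then c \<odot> x (i + 1) else \<zero>)"
    and j: "j \<in> {1..n}" and p: "p \<in> carrier R"
  shows "D j (E p) = (if j = i + 1 then inverse u \<odot> E (D j p) \<oplus> (c * u) \<odot> D i (K' p)
    else if j = i then u \<odot> E (D j p) else E (D j p))"
proof -
  note Ed = E_mon_up[OF assms(1)]
  let ?al = "\<lambda>r. c * u powi (int (r (Suc i)) - int (r i) + 1) * qnum (u\<^sup>2) (int (r i))"
  have cl: "K' p \<in> carrier R" "E (D j p) \<in> carrier R"
    using K'_mult E_lin D_lin[OF j] p by auto
  consider "j = Suc i" | "j = i" | "j \<noteq> i" "j \<noteq> Suc i" by blast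
  then show ?thesis
  proof cases
    case 1
    have "D j (E p) = inverse u \<odot> E (D j p) \<oplus> (c * u) \<odot> D i (K' p)"
    proof (rule D_E_aux[OF Ed j _ _ _ p])
      fix r :: "nat \<Rightarrow> nat"
      let ?r = "r(j := r j - 1)"
      let ?m = "omon x n (r(i := r i - 1))"
      have t: "tail n i r = r (Suc i) + tail n (Suc i) r" using i by (simp add: tail_Suc)
      show "(?al r * dcoef j (up r)) \<odot> omon x n ((up r)(j := up r j - 1)) =
        (inverse u * (dcoef j r * ?al ?r)) \<odot> omon x n (up ?r) \<oplus>
        (c * u * (inverse (kap r) * dcoef i r)) \<odot> ?m" (is "?a \<odot> ?m1 = ?b \<odot> ?m2 \<oplus> ?c \<odot> ?m")
      proof -
        have 11: "?m1 = ?m" using 1 by (simp add: up_def fun_upd_twist)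
        have 2: "?b \<odot> ?m2 = ?b \<odot> ?m"
        proof (cases "r (Suc i)")
          case (Suc a)
          then have "up (r(j := r j - 1)) = r(i := r i - 1)"
            using 1 by (auto simp: up_def fun_eq_iff)
          then show ?thesis by simp
        qed (use 1 in simp)
        have 3: "?b + ?c = ?a"
        proof (cases "r i")
          case (Suc a)
          have q: "qnum (u\<^sup>2) (int (Suc (r (Suc i)))) = inverse (u\<^sup>2) * qnum (u\<^sup>2) (int (r (Suc i))) + (u\<^sup>2) ^ r (Suc i)"
            by (rule qnum_Suc[OF u2])
          have dr: "up r (Suc i) = Suc (r (Suc i))" by (simp add: up_def)
          have dc: "dcoef j (up r) = (u\<^sup>2) ^ tail n (Suc i) r * (inverse (u\<^sup>2) * qnum (u\<^sup>2) (int (r (Suc i))) + (u\<^sup>2) ^ r (Suc i))"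
            using 1 Suc q tail_up[of r "Suc i"] dr by simp
          show ?thesis unfolding dc
            using 1 Suc t
            by (cases "r (Suc i)") (simp_all add: kap_def power_int_diff power_int_add power_int_minus power_add field_simps power2_eq_square power_mult_distrib)
        qed (use 1 in simp)
        show ?thesis unfolding 11 2 using 3 i by (subst smult_sum_cong[OF _ 3[symmetric]]) auto
      qed
    qed (use 1 i in auto)
    then show ?thesis using 1 by simp
  next
    case 2
    have "D j (E p) = u \<odot> E (D j p) \<oplus> 0 \<odot> D j (K' p)"
    proof (rule D_E_aux[OF Ed j j _ _ p])
      fix r :: "nat \<Rightarrow> nat"
      let ?r = "r(j := r j - 1)"
      have "(?al r * dcoef j (up r)) \<odot> omon x n ((up r)(j := up r j - 1)) =
        (u * (dcoef j r * ?al ?r)) \<odot> omon x n (up ?r)"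
      proof (cases "r i")
        case (Suc b)
        have "(up r)(j := up r j - 1) = up ?r" using 2 by (auto simp: up_def fun_eq_iff)
        moreover have "dcoef j (up r) = u\<^sup>2 * (u\<^sup>2) ^ tail n i r * qnum (u\<^sup>2) (int b)"
          using 2 Suc tail_up[of r i] by (simp add: up_def)
        moreover have "?al r * (u\<^sup>2 * (u\<^sup>2) ^ tail n i r * qnum (u\<^sup>2) (int b)) = u * (dcoef j r * ?al ?r)"
          using 2 Suc by (simp add: power_int_diff power_int_add field_simps power2_eq_square)
        ultimately show ?thesis by (simp only:)
      qed (use 2 in simp)
      then show "(?al r * dcoef j (up r)) \<odot> omon x n ((up r)(j := up r j - 1)) =
        (u * (dcoef j r * ?al ?r)) \<odot> omon x n (up ?r) \<oplus>
        (0 * (inverse (kap r) * dcoef j r)) \<odot> omon x n ?r" by simp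
    qed (use 2 in auto)
    then show ?thesis using 2 cl D_lin j by simp
  next
    case 3
    have "D j (E p) = 1 \<odot> E (D j p) \<oplus> 0 \<odot> D j (K' p)"
    proof (rule D_E_aux[OF Ed j j _ _ p])
      fix r :: "nat \<Rightarrow> nat"
      let ?r = "r(j := r j - 1)"
      have "(up r)(j := up r j - 1) = up ?r" using 3 by (auto simp: up_def fun_eq_iff)
      moreover have "?al r * dcoef j (up r) = 1 * (dcoef j r * ?al ?r)"
      proof (cases "r i")
        case (Suc b)
        then show ?thesis using 3 tail_up[of r j] by (simp add: up_def)
      qed (use 3 in simp)
      ultimately have "(?al r * dcoef j (up r)) \<odot> omon x n ((up r)(j := up r j - 1)) =
        (1 * (dcoef j r * ?al ?r)) \<odot> omon x n (up ?r)" by (simp only:)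
      then show "(?al r * dcoef j (up r)) \<odot> omon x n ((up r)(j := up r j - 1)) =
        (1 * (dcoef j r * ?al ?r)) \<odot> omon x n (up ?r) \<oplus>
        (0 * (inverse (kap r) * dcoef j r)) \<odot> omon x n ?r" by simp
    qed (use 3 in auto)
    then show ?thesis using 3 cl D_lin j by simp
  qed
qed

end

section \<open>Spanning monomials and the Laplace operator\<close>

context complex_algebra
begin

lemma mon_left_closed:
  assumes "\<And>k. k \<in> {1..m} \<Longrightarrow> x k \<in> carrier R" "G \<subseteq> carrier R"
    and "\<And>k y. k \<in> {1..m} \<Longrightarrow> y \<in> G \<Longrightarrow> x k \<otimes> y \<in> G" "y \<in> G"
  shows "omon x m r \<otimes> y \<in> G"
  using assms(1,3,4)
proof (induction m arbitrary: y)
  case 0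
  then show ?case using assms(2) by auto
next
  case (Suc m)
  have c: "x (Suc m) \<in> carrier R" "y \<in> carrier R" "omon x m r \<in> carrier R"
    using Suc.prems assms(2) by (auto intro!: mon_closed)
  note step = Suc.prems(2)[of "Suc m"] and y = Suc.prems(3)
  have "x (Suc m) [^] (k::nat) \<otimes> y \<in> G" for k
  proof (induction k)
    case (Suc k)
    have "x (Suc m) [^] Suc k \<otimes> y = x (Suc m) \<otimes> (x (Suc m) [^] k \<otimes> y)"
      using c by (metis nat_pow_Suc2 m_assoc nat_pow_closed)
    then show ?case using Suc step by simp
  qed (use c y in simp)
  then have "omon x m r \<otimes> (x (Suc m) [^] r (Suc m) \<otimes> y) \<in> G"
    by (intro Suc.IH Suc.prems) auto
  then show ?case using c by (simp add: m_assoc)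
qed

lemma finsum_rmult:
  assumes "finite S" "\<And>i. i \<in> S \<Longrightarrow> f i \<in> carrier R" "y \<in> carrier R"
  shows "(\<Oplus>i\<in>S. f i) \<otimes> y = (\<Oplus>i\<in>S. f i \<otimes> y)"
  using assms(1,2)
  by (induction S rule: finite_induct) (auto simp: assms(3) Pi_def l_distr)

text \<open>The cancellation behind both halves of the result: it handles the cross terms of the
  Laplace operator and, with all \<open>g j\<close> zero, the invariance of
  \<open>Q\<close>.\<close>

lemma finsum_commutes:
  assumes ab: "a \<in> {1..n}" "b \<in> {1..n}" "a \<noteq> b"
    and f: "\<And>j. j \<in> {1..n} \<Longrightarrow> f j \<in> carrier R" "\<And>j. j \<in> {1..n} \<Longrightarrow> g j \<in> carrier R"
    and x: "x \<in> carrier R" "f a = g a \<oplus> \<alpha> \<odot> x" "f b = g b \<oplus> \<beta> \<odot> x" "\<alpha> + \<beta> = 0"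
    and eq: "\<And>j. j \<in> {1..n} - {a, b} \<Longrightarrow> f j = g j"
  shows "(\<Oplus>j\<in>{1..n::nat}. f j) = (\<Oplus>j\<in>{1..n}. g j)"
proof -
  have S: "{1..n} = insert a (insert b ({1..n} - {a, b}))" using ab by auto
  have s: "(\<Oplus>j\<in>{1..n}. k j) = k a \<oplus> (k b \<oplus> (\<Oplus>j\<in>{1..n} - {a, b}. k j))"
    if "\<And>j. j \<in> {1..n} \<Longrightarrow> k j \<in> carrier R" for k
    using that ab by (subst S) (simp add: Pi_def)
  have r: "(\<Oplus>j\<in>{1..n} - {a, b}. f j) = (\<Oplus>j\<in>{1..n} - {a, b}. g j)"
    using f eq by (intro add.finprod_cong') auto
  have z: "\<alpha> \<odot> x \<oplus> \<beta> \<odot> x = \<zero>"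
    using add_smult[OF x(1), of \<alpha> \<beta>] x by simp
  let ?r = "\<Oplus>j\<in>{1..n} - {a, b}. g j"
  have c: "g a \<in> carrier R" "g b \<in> carrier R" "?r \<in> carrier R" "\<alpha> \<odot> x \<in> carrier R" "\<beta> \<odot> x \<in> carrier R"
    using f ab x by (auto intro!: finsum_closed)
  have "(g a \<oplus> \<alpha> \<odot> x) \<oplus> ((g b \<oplus> \<beta> \<odot> x) \<oplus> ?r) = (g a \<oplus> (g b \<oplus> ?r)) \<oplus> (\<alpha> \<odot> x \<oplus> \<beta> \<odot> x)"
    using c by (simp add: a_ac)
  also have "\<dots> = g a \<oplus> (g b \<oplus> ?r)" unfolding z using c by simp
  finally have *: "(g a \<oplus> \<alpha> \<odot> x) \<oplus> ((g b \<oplus> \<beta> \<odot> x) \<oplus> ?r) = g a \<oplus> (g b \<oplus> ?r)" .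
  have "(\<Oplus>j\<in>{1..n}. f j) = f a \<oplus> (f b \<oplus> ?r)"
    unfolding r[symmetric] by (rule s[OF f(1)])
  also have "\<dots> = (\<Oplus>j\<in>{1..n}. g j)"
    unfolding x(2,3) * by (rule s[OF f(2), symmetric])
  finally show ?thesis .
qed

text \<open>The factors \<open>v\<close> and \<open>inverse v\<close> cancel in each composite. The
  cross term at a arises in \<open>D a\<close>, and bringing \<open>H\<close> past
  \<open>B a\<close> gives the weight \<open>inverse v * \<alpha> * \<gamma>\<close>; the one at b
  arises already in \<open>B b\<close> with weight \<open>\<beta>\<close>. Both multiply the same
  vector \<open>D b (B a (H p))\<close>.\<close>

lemma laplace_commutes:
  assumes ab: "a \<in> {1..n}" "b \<in> {1..n}" "a \<noteq> b"
    and lin: "\<And>j. j \<in> {1..n} \<Longrightarrow> linear_operator R (D j)"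
      "\<And>j. j \<in> {1..n} \<Longrightarrow> linear_operator R (B j)" "linear_operator R E" "linear_operator R H"
    and DE: "\<And>j p. j \<in> {1..n} \<Longrightarrow> p \<in> carrier R \<Longrightarrow> D j (E p) =
      (if j = a then v \<odot> E (D j p) \<oplus> \<alpha> \<odot> D b (H p) else if j = b then inverse v \<odot> E (D j p) else E (D j p))"
    and BE: "\<And>j p. j \<in> {1..n} \<Longrightarrow> p \<in> carrier R \<Longrightarrow> B j (E p) =
      (if j = b then v \<odot> E (B j p) \<oplus> \<beta> \<odot> B a (H p) else if j = a then inverse v \<odot> E (B j p) else E (B j p))"
    and HB: "\<And>p. p \<in> carrier R \<Longrightarrow> H (B a p) = \<gamma> \<odot> B a (H p)"
    and v: "v \<noteq> 0" "inverse v * \<alpha> * \<gamma> + \<beta> = 0" and p: "p \<in> carrier R"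
  shows "(\<Oplus>j\<in>{1..n::nat}. D j (B j (E p))) = E (\<Oplus>j\<in>{1..n}. D j (B j p))"
proof -
  have "(\<Oplus>j\<in>{1..n}. D j (B j (E p))) = (\<Oplus>j\<in>{1..n}. E (D j (B j p)))"
  proof (rule finsum_commutes[OF ab])
    show "D b (B a (H p)) \<in> carrier R" using lin ab p by simp
    show "D a (B a (E p)) = E (D a (B a p)) \<oplus> (inverse v * \<alpha> * \<gamma>) \<odot> D b (B a (H p))"
      using ab lin p v by (simp add: BE DE HB lin_smult[OF lin(1)] smult_add mult.assoc)
    show "D b (B b (E p)) = E (D b (B b p)) \<oplus> \<beta> \<odot> D b (B a (H p))"
      using ab lin p v by (simp add: BE DE lin_smult[OF lin(1)] lin_add[OF lin(1)])
    show "D j (B j (E p)) = E (D j (B j p))" if "j \<in> {1..n} - {a, b}" for j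
      using that lin p by (simp add: BE DE)
  qed (use lin p v in simp_all)
  also have "\<dots> = E (\<Oplus>j\<in>{1..n}. D j (B j p))"
    using lin p by (subst lin_finsum[OF lin(3)]) auto
  finally show ?thesis .
qed

end

text \<open>The relations of the algebra in terms of \<open>h\<close>, with q = h^2 and q^2 = h^4.
  Generation is stated as induction by left multiplication because the spans below are shown to be
  stable under exactly these multiplications.\<close>

locale qspace = complex_algebra R for R :: "(complex, 'a) module" (structure) +
  fixes n :: nat and h :: complex and z w :: "nat \<Rightarrow> 'a"
  assumes h: "h \<noteq> 0" "h ^ 4 \<noteq> 1"
    and z_closed [simp]: "j \<in> {1..n} \<Longrightarrow> z j \<in> carrier R"
    and w_closed [simp]: "j \<in> {1..n} \<Longrightarrow> w j \<in> carrier R"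
    and zz: "1 \<le> k \<Longrightarrow> k < j \<Longrightarrow> j \<le> n \<Longrightarrow> z k \<otimes> z j = h\<^sup>2 \<odot> (z j \<otimes> z k)"
    and ww: "1 \<le> k \<Longrightarrow> k < j \<Longrightarrow> j \<le> n \<Longrightarrow> w k \<otimes> w j = (inverse h)\<^sup>2 \<odot> (w j \<otimes> w k)"
    and wz: "k \<in> {1..n} \<Longrightarrow> j \<in> {1..n} \<Longrightarrow> k \<noteq> j \<Longrightarrow> w j \<otimes> z k = h\<^sup>2 \<odot> (z k \<otimes> w j)"
    and wz_diag: "k \<in> {1..n} \<Longrightarrow>
      w k \<otimes> z k = z k \<otimes> w k \<oplus> (1 - h ^ 4) \<odot> (\<Oplus>s\<in>{1..<k}. z s \<otimes> w s)"
    and generated: "p \<in> carrier R \<Longrightarrow> P \<one> \<Longrightarrow>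
      (\<And>x y. x \<in> carrier R \<Longrightarrow> y \<in> carrier R \<Longrightarrow> P x \<Longrightarrow> P y \<Longrightarrow> P (x \<oplus> y)) \<Longrightarrow>
      (\<And>c x. x \<in> carrier R \<Longrightarrow> P x \<Longrightarrow> P (c \<odot> x)) \<Longrightarrow>
      (\<And>j x. j \<in> {1..n} \<Longrightarrow> x \<in> carrier R \<Longrightarrow> P x \<Longrightarrow> P (z j \<otimes> x)) \<Longrightarrow>
      (\<And>j x. j \<in> {1..n} \<Longrightarrow> x \<in> carrier R \<Longrightarrow> P x \<Longrightarrow> P (w j \<otimes> x)) \<Longrightarrow> P p"
begin

sublocale Z: coords R n z h
  by standard (auto simp: h zz)

lemma inverse_h4: "inverse h ^ 4 \<noteq> 1"
  using h by (simp add: power_inverse inverse_eq_iff_eq[where b = 1, simplified])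

sublocale W: coords R n w "inverse h"
  by standard (use h inverse_h4 in \<open>auto simp: ww\<close>)

section \<open>Normal ordering: both kinds of ordered monomials span\<close>

definition zw_span :: "'a set" where "zw_span = lspan {omon z n r \<otimes> omon w n s | r s. True}"
definition wz_span :: "'a set" where "wz_span = lspan {omon w n r \<otimes> omon z n s | r s. True}"

lemma zw_basis_closed: "{omon z n r \<otimes> omon w n s | r s. True} \<subseteq> carrier R"
  and wz_basis_closed: "{omon w n r \<otimes> omon z n s | r s. True} \<subseteq> carrier R"
  by auto

lemma span_closed: "zw_span \<subseteq> carrier R" "wz_span \<subseteq> carrier R"
  unfolding zw_span_def wz_span_def
  using lspan_closed[OF zw_basis_closed] lspan_closed[OF wz_basis_closed] by auto

lemma zw_span_left:
  assumes j: "j \<in> {1..n}" and y: "y \<in> zw_span"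
  shows "z j \<otimes> y \<in> zw_span"
  unfolding zw_span_def
proof (rule lspan_image[OF zw_basis_closed lin_lmult _ y[unfolded zw_span_def]])
  fix x assume "x \<in> {omon z n r \<otimes> omon w n s | r s. True}"
  then obtain r s where x: "x = omon z n r \<otimes> omon w n s" by blast
  obtain c where c: "z j \<otimes> omon z n r = c \<odot> omon z n (r(j := Suc (r j)))"
    using Z.left_mult_mon[OF j] by blast
  have "z j \<otimes> x = c \<odot> (omon z n (r(j := Suc (r j))) \<otimes> omon w n s)"
    using j unfolding x by (simp add: m_assoc[symmetric] c)
  then show "z j \<otimes> x \<in> lspan {omon z n r \<otimes> omon w n s | r s. True}"
    by (auto intro!: lspan.intros)
qed (use j in simp)

lemma wz_span_left:
  assumes j: "j \<in> {1..n}" and y: "y \<in> wz_span"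
  shows "w j \<otimes> y \<in> wz_span"
  unfolding wz_span_def
proof (rule lspan_image[OF wz_basis_closed lin_lmult _ y[unfolded wz_span_def]])
  fix x assume "x \<in> {omon w n r \<otimes> omon z n s | r s. True}"
  then obtain r s where x: "x = omon w n r \<otimes> omon z n s" by blast
  obtain c where c: "w j \<otimes> omon w n r = c \<odot> omon w n (r(j := Suc (r j)))"
    using W.left_mult_mon[OF j] by blast
  have "w j \<otimes> x = c \<odot> (omon w n (r(j := Suc (r j))) \<otimes> omon z n s)"
    using j unfolding x by (simp add: m_assoc[symmetric] c)
  then show "w j \<otimes> x \<in> lspan {omon w n r \<otimes> omon z n s | r s. True}"
    by (auto intro!: lspan.intros)
qed (use j in simp)

lemma zw_span_ops:
  "x \<in> zw_span \<Longrightarrow> y \<in> zw_span \<Longrightarrow> x \<oplus> y \<in> zw_span" "x \<in> zw_span \<Longrightarrow> c \<odot> x \<in> zw_span"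
  "finite S \<Longrightarrow> (\<And>i. i \<in> S \<Longrightarrow> f i \<in> zw_span) \<Longrightarrow> (\<Oplus>i\<in>S. f i) \<in> zw_span"
  unfolding zw_span_def by (blast intro: lspan.intros lspan_finsum[OF zw_basis_closed])+

lemma wz_span_ops:
  "x \<in> wz_span \<Longrightarrow> y \<in> wz_span \<Longrightarrow> x \<oplus> y \<in> wz_span" "x \<in> wz_span \<Longrightarrow> c \<odot> x \<in> wz_span"
  "finite S \<Longrightarrow> (\<And>i. i \<in> S \<Longrightarrow> f i \<in> wz_span) \<Longrightarrow> (\<Oplus>i\<in>S. f i) \<in> wz_span"
  unfolding wz_span_def by (blast intro: lspan.intros lspan_finsum[OF wz_basis_closed])+

lemma diag_mult:
  assumes k: "k \<in> {1..n}" and y: "y \<in> carrier R"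
  shows "w k \<otimes> (z k \<otimes> y) = z k \<otimes> (w k \<otimes> y) \<oplus> (1 - h ^ 4) \<odot> (\<Oplus>s\<in>{1..<k}. z s \<otimes> (w s \<otimes> y))"
proof -
  have c: "z s \<in> carrier R" "w s \<in> carrier R" if "s \<in> {1..<k}" for s using that k by auto
  have S: "(\<Oplus>s\<in>{1..<k}. z s \<otimes> w s) \<in> carrier R" using c by (intro finsum_closed) auto
  have "w k \<otimes> (z k \<otimes> y) = (z k \<otimes> w k \<oplus> (1 - h ^ 4) \<odot> (\<Oplus>s\<in>{1..<k}. z s \<otimes> w s)) \<otimes> y"
    unfolding wz_diag[OF k, symmetric] using k y by (simp add: m_assoc)
  also have "\<dots> = z k \<otimes> (w k \<otimes> y) \<oplus> (1 - h ^ 4) \<odot> (\<Oplus>s\<in>{1..<k}. (z s \<otimes> w s) \<otimes> y)"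
    using k y S finsum_rmult[of "{1..<k}" "\<lambda>s. z s \<otimes> w s" y] c by (simp add: l_distr m_assoc Pi_def)
  also have "(\<Oplus>s\<in>{1..<k}. (z s \<otimes> w s) \<otimes> y) = (\<Oplus>s\<in>{1..<k}. z s \<otimes> (w s \<otimes> y))"
    using c y by (intro add.finprod_cong') (auto simp: m_assoc)
  finally show ?thesis .
qed

lemma zw_span_w:
  assumes j: "j \<in> {1..n}" and y: "y \<in> zw_span"
  shows "w j \<otimes> y \<in> zw_span"
  unfolding zw_span_def
proof (rule lspan_image[OF zw_basis_closed lin_lmult _ y[unfolded zw_span_def]])
  \<comment> \<open>The condition is imposed for all j at once: exchanging \<open>w k\<close> with
    \<open>z k\<close> in front of y produces \<open>w s \<otimes> y\<close> for every s < k. The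
    set contains the monomials in the w's and is stable under the z's, hence contains all spanning
    monomials.\<close>
  define G where "G = {y \<in> zw_span. \<forall>j\<in>{1..n}. w j \<otimes> y \<in> zw_span}"
  have G: "z k \<otimes> y \<in> G" if k: "k \<in> {1..n}" and y: "y \<in> G" for k y
  proof -
    have yc: "y \<in> carrier R" using y span_closed by (auto simp: G_def)
    have "w j \<otimes> (z k \<otimes> y) \<in> zw_span" if j: "j \<in> {1..n}" for j
    proof (cases "j = k")
      case True
      show ?thesis unfolding True diag_mult[OF k yc]
        using k y by (auto intro!: zw_span_ops zw_span_left simp: G_def)
    next
      case False
      have "w j \<otimes> (z k \<otimes> y) = h\<^sup>2 \<odot> (z k \<otimes> (w j \<otimes> y))"
        using j k yc wz[OF k j] False by (simp add: m_assoc[symmetric])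
      then show ?thesis using j k y by (auto intro!: zw_span_ops zw_span_left simp: G_def)
    qed
    then show ?thesis using k y by (auto simp: G_def intro: zw_span_left)
  qed
  have zw: "omon z n r \<otimes> omon w n s \<in> zw_span" for r s
    unfolding zw_span_def by (auto intro: lspan.base)
  have w1: "omon w n s \<in> zw_span" for s
    using zw[of "\<lambda>_. 0" s] by (simp add: mon_zero)
  have "omon w n s \<in> G" for s
    unfolding G_def using W.left_mult_mon[of _ s] w1 zw_span_ops(2) by (auto; metis)
  then have "omon z n r \<otimes> omon w n s \<in> G" for r s
    by (intro mon_left_closed[where G = G] G) (use span_closed in \<open>auto simp: G_def\<close>)
  then show "w j \<otimes> x \<in> lspan {omon z n r \<otimes> omon w n s | r s. True}"
    if "x \<in> {omon z n r \<otimes> omon w n s | r s. True}" for x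
    using that j unfolding G_def zw_span_def by blast
qed (use j in simp)

lemma wz_span_z:
  assumes j: "j \<in> {1..n}" and y: "y \<in> wz_span"
  shows "z j \<otimes> y \<in> wz_span"
  unfolding wz_span_def
proof (rule lspan_image[OF wz_basis_closed lin_lmult _ y[unfolded wz_span_def]])
  define G where "G = {y \<in> wz_span. \<forall>j\<in>{1..n}. z j \<otimes> y \<in> wz_span}"
  have G: "w k \<otimes> y \<in> G" if k: "k \<in> {1..n}" and y: "y \<in> G" for k y
  proof -
    have yc: "y \<in> carrier R" using y span_closed by (auto simp: G_def)
    \<comment> \<open>Solved for z_k w_k, the diagonal relation leaves products z_s w_s with s < k
      that are still in the wrong order, hence the strong induction on k.\<close>
    have diag: "k \<in> {1..n} \<Longrightarrow> z k \<otimes> (w k \<otimes> y) \<in> wz_span" for k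
    proof (induction k rule: less_induct)
      case (less k)
      let ?S = "\<Oplus>s\<in>{1..<k}. z s \<otimes> (w s \<otimes> y)"
      have S: "?S \<in> wz_span" using less by (intro wz_span_ops) auto
      have Sc: "?S \<in> carrier R" using S span_closed by auto
      have "(1 - h ^ 4) \<odot> ?S \<oplus> (h ^ 4 - 1) \<odot> ?S = \<zero>"
        using add_smult[OF Sc, of "1 - h ^ 4" "h ^ 4 - 1"] Sc by simp
      then have "z k \<otimes> (w k \<otimes> y) = w k \<otimes> (z k \<otimes> y) \<oplus> (h ^ 4 - 1) \<odot> ?S"
        using diag_mult[OF less.prems yc] less.prems yc Sc by (simp add: a_assoc)
      moreover have "w k \<otimes> (z k \<otimes> y) \<in> wz_span"
        using less.prems y by (auto intro!: wz_span_left simp: G_def)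
      ultimately show ?case using S by (auto intro!: wz_span_ops)
    qed
    have "z j \<otimes> (w k \<otimes> y) \<in> wz_span" if j: "j \<in> {1..n}" for j
    proof (cases "j = k")
      case True
      show ?thesis unfolding True by (rule diag[OF k])
    next
      case False
      have "z j \<otimes> w k = (1 / h\<^sup>2) \<odot> (w k \<otimes> z j)"
        using j k False h wz[OF j k] by simp
      then have "z j \<otimes> (w k \<otimes> y) = (1 / h\<^sup>2) \<odot> (w k \<otimes> (z j \<otimes> y))"
        using j k yc by (simp add: m_assoc[symmetric])
      then show ?thesis using j k y by (auto intro!: wz_span_ops wz_span_left simp: G_def)
    qed
    then show ?thesis using k y by (auto simp: G_def intro: wz_span_left)
  qed
  have zw: "omon w n r \<otimes> omon z n s \<in> wz_span" for r s
    unfolding wz_span_def by (auto intro: lspan.base)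
  have w1: "omon z n s \<in> wz_span" for s
    using zw[of "\<lambda>_. 0" s] by (simp add: mon_zero)
  have "omon z n s \<in> G" for s
    unfolding G_def using Z.left_mult_mon[of _ s] w1 wz_span_ops(2) by (auto; metis)
  then have "omon w n r \<otimes> omon z n s \<in> G" for r s
    by (intro mon_left_closed[where G = G] G) (use span_closed in \<open>auto simp: G_def\<close>)
  then show "z j \<otimes> x \<in> lspan {omon w n r \<otimes> omon z n s | r s. True}"
    if "x \<in> {omon w n r \<otimes> omon z n s | r s. True}" for x
    using that j unfolding G_def wz_span_def by blast
qed (use j in simp)

lemma spans:
  assumes "p \<in> carrier R" shows "p \<in> zw_span" "p \<in> wz_span"
proof -
  have "omon z n r \<otimes> omon w n s \<in> zw_span" "omon w n r \<otimes> omon z n s \<in> wz_span" for r s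
    unfolding zw_span_def wz_span_def by (auto intro: lspan.base)
  from this[of "\<lambda>_. 0" "\<lambda>_. 0"] have one: "\<one> \<in> zw_span" "\<one> \<in> wz_span"
    by (simp_all add: mon_zero)
  show "p \<in> zw_span"
    by (rule generated[OF assms, where P = "\<lambda>p. p \<in> zw_span"])
      (auto intro: one zw_span_ops zw_span_left zw_span_w)
  show "p \<in> wz_span"
    by (rule generated[OF assms, where P = "\<lambda>p. p \<in> wz_span"])
      (auto intro: one wz_span_ops wz_span_left wz_span_z)
qed

end

section \<open>The Laplace operator under group-like elements and skew derivations\<close>

locale qspace_diff = qspace R n h z w for R :: "(complex, 'a) module" (structure) and n h z w +
  fixes D B :: "nat \<Rightarrow> 'a \<Rightarrow> 'a"
  assumes D_lin: "j \<in> {1..n} \<Longrightarrow> linear_operator R (D j)"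
    and B_lin: "j \<in> {1..n} \<Longrightarrow> linear_operator R (B j)"
    and D_mon: "j \<in> {1..n} \<Longrightarrow> D j (omon z n r \<otimes> omon w n s) =
      ((h\<^sup>2) ^ tail n j r * qnum (h\<^sup>2) (int (r j))) \<odot> (omon z n (r(j := r j - 1)) \<otimes> omon w n s)"
    and B_mon: "j \<in> {1..n} \<Longrightarrow> B j (omon w n r \<otimes> omon z n s) =
      ((inverse (h\<^sup>2)) ^ tail n j r * qnum (h\<^sup>2) (int (r j))) \<odot> (omon w n (r(j := r j - 1)) \<otimes> omon z n s)"
begin

sublocale Z: coords_diff R n z h w D
  by standard (use spans D_lin D_mon in \<open>auto simp: zw_span_def\<close>)

text \<open>In the derivatives on the w's the tail power has base q^(-1) while the q-number has base
  q. Since [a] is unchanged under inverting q, this is the same setting with parameter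
  \<open>inverse h\<close>.\<close>

sublocale W: coords_diff R n w "inverse h" z B
  by standard (use spans B_lin B_mon in \<open>auto simp: wz_span_def power_inverse qnum_inverse\<close>)

definition laplace :: "'a \<Rightarrow> 'a" where
  "laplace p = (\<Oplus>j\<in>{1..n}. D j (B j p))"

lemma laplace_closed [simp]: "p \<in> carrier R \<Longrightarrow> laplace p \<in> carrier R"
  unfolding laplace_def using D_lin B_lin by (intro finsum_closed) auto

text \<open>Because z_j and w_j have inverse eigenvalues, the scalar picked up by \<open>D j\<close>
  cancels the one picked up by \<open>B j\<close>, term by term.\<close>

lemma laplace_group_like:
  assumes H: "multiplicative H"
    and Hz: "\<And>j. j \<in> {1..n} \<Longrightarrow> H (z j) = \<chi> j \<odot> z j"
    and Hw: "\<And>j. j \<in> {1..n} \<Longrightarrow> H (w j) = inverse (\<chi> j) \<odot> w j"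
    and \<chi>: "\<And>j. j \<in> {1..n} \<Longrightarrow> \<chi> j \<noteq> 0" and p: "p \<in> carrier R"
  shows "laplace (H p) = H (laplace p)"
proof -
  have Mz: "\<exists>b. H (omon z n s) = b \<odot> omon z n s" for s
    by (rule exI, rule mult_mon[OF H z_closed Hz])
  have Mw: "\<exists>b. H (omon w n s) = b \<odot> omon w n s" for s
    by (rule exI, rule mult_mon[OF H w_closed Hw])
  have comm: "D j (H q) = \<chi> j \<odot> H (D j q)" "B j (H q) = inverse (\<chi> j) \<odot> H (B j q)"
    if "j \<in> {1..n}" "q \<in> carrier R" for j q
    using Z.D_mult[OF H Hz Mw that] W.D_mult[OF H Hw Mz that] by auto
  have "D j (B j (H p)) = H (D j (B j p))" if j: "j \<in> {1..n}" for j
    using H j p \<chi>[OF j] B_lin[OF j] D_lin[OF j] comm(2)[OF j p] comm(1)[OF j, of "B j p"]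
    by (simp add: lin_smult[OF D_lin[OF j]])
  then have "laplace (H p) = (\<Oplus>j\<in>{1..n}. H (D j (B j p)))"
    unfolding laplace_def using H B_lin D_lin p by (intro add.finprod_cong') auto
  also have "\<dots> = H (laplace p)"
    unfolding laplace_def using H B_lin D_lin p by (subst lin_finsum) auto
  finally show ?thesis .
qed

end

locale qspace_skew = qspace_diff R n h z w D B + skew R E K K'
  for R :: "(complex, 'a) module" (structure) and n h z w D B E K K' +
  fixes i :: nat
  assumes i: "1 \<le> i" "i < n"
    and K_z: "j \<in> {1..n} \<Longrightarrow> K (z j) = (if j = i then h else if j = i + 1 then inverse h else 1) \<odot> z j"
    and K'_z: "j \<in> {1..n} \<Longrightarrow> K' (z j) = (if j = i then inverse h else if j = i + 1 then h else 1) \<odot> z j"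
    and K_w: "j \<in> {1..n} \<Longrightarrow> K (w j) = (if j = i then inverse h else if j = i + 1 then h else 1) \<odot> w j"
    and K'_w: "j \<in> {1..n} \<Longrightarrow> K' (w j) = (if j = i then h else if j = i + 1 then inverse h else 1) \<odot> w j"
begin

sublocale SZ: skew_coords R n z h E K K' i
  by standard (use i K_z K'_z in auto)

sublocale SW: skew_coords R n w "inverse h" E K K' i
  by standard (use i K_w K'_w in auto)

lemma K'_B: "j \<in> {i, i + 1} \<Longrightarrow> p \<in> carrier R \<Longrightarrow>
    K' (B j p) = (if j = i then inverse h else h) \<odot> B j (K' p)"
proof -
  assume j: "j \<in> {i, i + 1}" and p: "p \<in> carrier R"
  have "\<exists>b. K' (omon z n s) = b \<odot> omon z n s" for s
    using SZ.K'_mon[of n s] i by auto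
  then have "B j (K' p) = (if j = i then h else if j = i + 1 then inverse h else 1) \<odot> K' (B j p)"
    using j i p by (intro W.D_mult[OF K'_mult K'_w]) auto
  moreover have "K' (B j p) \<in> carrier R" using K'_mult B_lin[of j] i j p by auto
  ultimately show ?thesis using j h by auto
qed

lemma laplace_lowering:
  assumes Ez: "\<And>j. j \<in> {1..n} \<Longrightarrow> E (z j) = (if j = i + 1 then z i else \<zero>)"
    and Ew: "\<And>j. j \<in> {1..n} \<Longrightarrow> E (w j) = (if j = i then (- inverse (h\<^sup>2)) \<odot> w (i + 1) else \<zero>)"
    and p: "p \<in> carrier R"
  shows "laplace (E p) = E (laplace p)"
proof -
  have Ez': "E (z j) = (if j = i + 1 then 1 \<odot> z i else \<zero>)" if "j \<in> {1..n}" for j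
    using Ez[OF that] i by simp
  interpret DZ: skew_diff R n z h w D E K K' i
    by standard (use SW.E_mon_up[OF Ew] SW.K'_mon[of n] i in auto)
  interpret DW: skew_diff R n w "inverse h" z B E K K' i
    by standard (use SZ.E_mon_down[OF Ez'] SZ.K'_mon[of n] i in auto)
  \<comment> \<open>On the z's the move is downward with c = 1 and u = h, so \<open>\<alpha>\<close>
    = c/u; on the w's it is upward with c = -h^(-2) and u = h^(-1), so \<open>\<beta>\<close> = c u.
    \<open>\<gamma>\<close> comes from exchanging \<open>K'\<close> with \<open>B i\<close>. The
    cross weights are h^(-3) and -h^(-3).\<close>
  show ?thesis unfolding laplace_def
    by (rule laplace_commutes[where a = i and b = "i + 1" and v = h and H = K' and
          \<alpha> = "1 / h" and \<beta> = "- inverse (h\<^sup>2) * inverse h" and \<gamma> = "inverse h"])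
      (use i h p D_lin B_lin E_lin K'_mult K'_B DZ.D_down[OF Ez'] DW.D_up[OF Ew] in
        \<open>auto simp: field_simps power2_eq_square\<close>)
qed

lemma laplace_raising:
  assumes Ez: "\<And>j. j \<in> {1..n} \<Longrightarrow> E (z j) = (if j = i then z (i + 1) else \<zero>)"
    and Ew: "\<And>j. j \<in> {1..n} \<Longrightarrow> E (w j) = (if j = i + 1 then (- h\<^sup>2) \<odot> w i else \<zero>)"
    and p: "p \<in> carrier R"
  shows "laplace (E p) = E (laplace p)"
proof -
  have Ez': "E (z j) = (if j = i then 1 \<odot> z (i + 1) else \<zero>)" if "j \<in> {1..n}" for j
    using Ez[OF that] i by simp
  interpret DZ: skew_diff R n z h w D E K K' i
    by standard (use SW.E_mon_down[OF Ew] SW.K'_mon[of n] i in auto)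
  interpret DW: skew_diff R n w "inverse h" z B E K K' i
    by standard (use SZ.E_mon_up[OF Ez'] SZ.K'_mon[of n] i in auto)
  \<comment> \<open>The directions are exchanged: \<open>\<alpha>\<close> = c u with c = 1 and u =
    h, \<open>\<beta>\<close> = c/u with c = -h^2 and u = h^(-1). The cross weights are h^3 and
    -h^3.\<close>
  show ?thesis unfolding laplace_def
    by (rule laplace_commutes[where a = "i + 1" and b = i and v = "inverse h" and H = K' and
          \<alpha> = "1 * h" and \<beta> = "- h\<^sup>2 / inverse h" and \<gamma> = h])
      (use i h p D_lin B_lin E_lin K'_mult K'_B DZ.D_up[OF Ez'] DW.D_down[OF Ew] in
        \<open>auto simp: field_simps power2_eq_square\<close>)
qed

text \<open>\<open>E\<close> kills w_a and z_b, so E(z_a w_a) = z_b K'(w_a) and E(z_b w_b) = K(z_b)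
  E(w_b). Both are multiples of z_b w_a, and hypothesis \<open>c\<close> says that the two
  coefficients cancel.\<close>

lemma Q_invariant:
  assumes a: "a \<in> {1..n}" and b: "b \<in> {1..n}" and ab: "a \<noteq> b" "{a, b} = {i, i + 1}"
    and Ez: "\<And>j. j \<in> {1..n} \<Longrightarrow> E (z j) = (if j = a then z b else \<zero>)"
    and Ew: "\<And>j. j \<in> {1..n} \<Longrightarrow> E (w j) = (if j = b then c \<odot> w a else \<zero>)"
    and c: "(if a = i then h else inverse h) + (if b = i then h else inverse h) * c = 0"
  shows "E (\<Oplus>j\<in>{1..n}. z j \<otimes> w j) = \<zero>"
proof -
  have "(\<Oplus>j\<in>{1..n}. E (z j \<otimes> w j)) = (\<Oplus>j\<in>{1..n}. \<zero>)"
  proof (rule finsum_commutes[OF a b ab(1)])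
    show "z b \<otimes> w a \<in> carrier R" using a b by simp
    show "E (z a \<otimes> w a) = \<zero> \<oplus> (if a = i then h else inverse h) \<odot> (z b \<otimes> w a)"
      using a b ab K'_w[of a] K_mult by (auto simp: E_mult Ez Ew doubleton_eq_iff)
    show "E (z b \<otimes> w b) = \<zero> \<oplus> ((if b = i then h else inverse h) * c) \<odot> (z b \<otimes> w a)"
      using a b ab K_z[of b] K'_mult by (auto simp: E_mult Ez Ew doubleton_eq_iff mult.commute)
    show "E (z j \<otimes> w j) = \<zero>" if "j \<in> {1..n} - {a, b}" for j
      using that K_mult K'_mult by (simp add: E_mult Ez Ew)
  qed (use c E_lin in auto)
  then show ?thesis using E_lin by (subst lin_finsum) auto
qed

end

context qspace_diff
begin

text \<open>Makes commuting with the Laplace operator stable under linear combinations of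
  operators.\<close>

lemma laplace_lin: "linear_operator R laplace"
proof -
  have "laplace (c \<odot> p) = c \<odot> laplace p" if "p \<in> carrier R" for c p
  proof -
    have "laplace (c \<odot> p) = (\<Oplus>j\<in>{1..n}. c \<odot> D j (B j p))"
      unfolding laplace_def using that B_lin D_lin
      by (intro add.finprod_cong') (auto simp: lin_smult[OF B_lin] lin_smult[OF D_lin])
    then show ?thesis unfolding laplace_def
      using lin_finsum[OF lin_scale[OF lin_id], of "{1..n}" "\<lambda>j. D j (B j p)" c] that B_lin D_lin by simp
  qed
  moreover have "laplace (p \<oplus> p') = laplace p \<oplus> laplace p'"
    if "p \<in> carrier R" "p' \<in> carrier R" for p p'
  proof -
    have "laplace (p \<oplus> p') = (\<Oplus>j\<in>{1..n}. D j (B j p) \<oplus> D j (B j p'))"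
      unfolding laplace_def using that B_lin D_lin
      by (intro add.finprod_cong') (auto simp: lin_add[OF B_lin] lin_add[OF D_lin])
    also have "\<dots> = laplace p \<oplus> laplace p'"
      unfolding laplace_def using that B_lin D_lin by (intro finsum_addf) auto
    finally show ?thesis .
  qed
  ultimately show ?thesis by (auto simp: linear_operator_def)
qed

definition Q :: 'a where "Q = (\<Oplus>j\<in>{1..n}. z j \<otimes> w j)"

lemma Q_closed [simp]: "Q \<in> carrier R"
  unfolding Q_def by (intro finsum_closed) auto

lemma Q_group_like:
  assumes "multiplicative H" "\<And>j. j \<in> {1..n} \<Longrightarrow> H (z j) = \<chi> j \<odot> z j"
    and "\<And>j. j \<in> {1..n} \<Longrightarrow> H (w j) = inverse (\<chi> j) \<odot> w j"
    and "\<And>j. j \<in> {1..n} \<Longrightarrow> \<chi> j \<noteq> 0"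
  shows "H Q = Q"
proof -
  have "H Q = (\<Oplus>j\<in>{1..n}. H (z j \<otimes> w j))"
    unfolding Q_def using assms(1) by (subst lin_finsum) auto
  also have "\<dots> = Q"
    unfolding Q_def using assms by (intro add.finprod_cong') auto
  finally show ?thesis .
qed

end

section \<open>Presented algebras\<close>

lemma free_alg_closed [simp]:
  "0 \<in> carrier (free_alg G)" "1 \<in> carrier (free_alg G)" "fconst c \<in> carrier (free_alg G)"
  "g \<in> G \<Longrightarrow> fgen g \<in> carrier (free_alg G)"
  "p \<in> carrier (free_alg G) \<Longrightarrow> p' \<in> carrier (free_alg G) \<Longrightarrow> p + p' \<in> carrier (free_alg G)"
  "p \<in> carrier (free_alg G) \<Longrightarrow> p' \<in> carrier (free_alg G) \<Longrightarrow> p * p' \<in> carrier (free_alg G)"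
  "p \<in> carrier (free_alg G) \<Longrightarrow> p' \<in> carrier (free_alg G) \<Longrightarrow> p - p' \<in> carrier (free_alg G)"
  "p \<in> carrier (free_alg G) \<Longrightarrow> - p \<in> carrier (free_alg G)"
  "p \<in> carrier (free_alg G) \<Longrightarrow> p ^ k \<in> carrier (free_alg G)"
proof -
  show one: "1 \<in> carrier (free_alg G)"
    by (auto simp: free_alg_def zero_fword_def simp flip: single_one split: if_splits)
  show mult: "p * p' \<in> carrier (free_alg G)"
    if "p \<in> carrier (free_alg G)" "p' \<in> carrier (free_alg G)" for p p'
  proof -
    have "set (letters u) \<subseteq> G" if u: "u \<in> Poly_Mapping.keys (p * p')" for u
    proof -
      obtain a b where "u = a + b" "a \<in> Poly_Mapping.keys p" "b \<in> Poly_Mapping.keys p'"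
        using u keys_mult[of p p'] by blast
      then show ?thesis
        using \<open>p \<in> carrier (free_alg G)\<close> \<open>p' \<in> carrier (free_alg G)\<close> by (auto simp: free_alg_def plus_fword_def)
    qed
    then show ?thesis by (simp add: free_alg_def)
  qed
  show "p ^ k \<in> carrier (free_alg G)" if "p \<in> carrier (free_alg G)"
    by (induction k) (use that one mult in auto)
  show "p + p' \<in> carrier (free_alg G)"
    if "p \<in> carrier (free_alg G)" "p' \<in> carrier (free_alg G)"
    using that Poly_Mapping.keys_add[of p p'] by (auto simp: free_alg_def)
  show "p - p' \<in> carrier (free_alg G)"
    if "p \<in> carrier (free_alg G)" "p' \<in> carrier (free_alg G)"
    using that keys_diff[of p p'] by (auto simp: free_alg_def)
qed (auto simp: free_alg_def fconst_def fgen_def zero_fword_def split: if_splits)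

lemma free_alg_sum [simp]:
  "(\<And>i. i \<in> S \<Longrightarrow> f i \<in> carrier (free_alg G)) \<Longrightarrow> sum f S \<in> carrier (free_alg G)"
  by (induction S rule: infinite_finite_induct) auto

lemma free_alg_prod_list:
  "(\<And>x. x \<in> set xs \<Longrightarrow> x \<in> carrier (free_alg G)) \<Longrightarrow> prod_list xs \<in> carrier (free_alg G)"
  by (induction xs) auto

lemma free_alg_simps [simp]:
  "mult (free_alg G) = (*)" "one (free_alg G) = 1" "zero (free_alg G) = 0" "add (free_alg G) = (+)"
  by (simp_all add: free_alg_def)

lemma ring_free_alg: "ring (free_alg G)"
proof (rule ringI)
  show "abelian_group (free_alg G)"
    by (rule abelian_groupI) (auto simp: add_ac intro!: bexI[of _ "- _"])
  show "monoid (free_alg G)"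
    by (rule monoidI) (auto simp: mult.assoc)
qed (auto simp: algebra_simps)

lemma free_alg_minus:
  assumes "x \<in> carrier (free_alg G)" "y \<in> carrier (free_alg G)"
  shows "x \<ominus>\<^bsub>free_alg G\<^esub> y = x - y"
proof -
  interpret ring "free_alg G" by (rule ring_free_alg)
  have "\<ominus>\<^bsub>free_alg G\<^esub> y = - y"
    using assms by (intro minus_equality) auto
  then show ?thesis by (simp add: a_minus_def)
qed

lemma fconst_simps:
  "fconst 0 = 0" "fconst 1 = 1" "fconst (c * d) = fconst c * fconst d" "fconst (c + d) = fconst c + fconst d"
  by (simp_all add: fconst_def single_add mult_single)

lemma poly_mapping_sum_single:
  "(p :: 'b \<Rightarrow>\<^sub>0 complex) = (\<Sum>u\<in>Poly_Mapping.keys p. Poly_Mapping.single u (Poly_Mapping.lookup p u))"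
proof (rule poly_mapping_eqI)
  fix k
  have "(\<Sum>u\<in>Poly_Mapping.keys p. Poly_Mapping.lookup (Poly_Mapping.single u (Poly_Mapping.lookup p u)) k) =
      (\<Sum>u\<in>Poly_Mapping.keys p. if k = u then Poly_Mapping.lookup p k else 0)"
    by (rule sum.cong) (auto simp: lookup_single when_def)
  also have "\<dots> = Poly_Mapping.lookup p k"
    by (auto simp: in_keys_iff)
  finally show "Poly_Mapping.lookup p k = Poly_Mapping.lookup
      (\<Sum>u\<in>Poly_Mapping.keys p. Poly_Mapping.single u (Poly_Mapping.lookup p u)) k"
    by (simp add: lookup_sum)
qed

text \<open>Scalars sit in the free algebra as multiples of the empty word. Their centrality is what
  turns multiplication by their classes into a scalar action on the quotient.\<close>

lemma fconst_commutes: "p * fconst c = fconst c * (p :: 'g falg)"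
proof -
  let ?s = "\<Sum>u\<in>Poly_Mapping.keys p. Poly_Mapping.single u (Poly_Mapping.lookup p u)"
  have "?s * fconst c = fconst c * ?s"
    by (simp add: sum_distrib_left sum_distrib_right fconst_def mult_single mult.commute)
  then show ?thesis unfolding poly_mapping_sum_single[symmetric] .
qed

lemma single_Word: "Poly_Mapping.single (Word us) c = fconst c * prod_list (map fgen us)"
proof (induction us arbitrary: c)
  case Nil
  then show ?case by (simp add: fconst_def zero_fword_def)
next
  case (Cons g us)
  have "fconst c * prod_list (map fgen (g # us)) = fgen g * (fconst c * prod_list (map fgen us))"
    by (simp add: mult.assoc[symmetric] fconst_commutes)
  also have "\<dots> = Poly_Mapping.single (Word (g # us)) c"
    unfolding Cons[symmetric] by (simp add: fgen_def mult_single plus_fword_def)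
  finally show ?case by simp
qed

section \<open>The quotient by the relations as a complex algebra\<close>

locale presented =
  fixes G :: "'g set" and Rl :: "('g falg \<times> 'g falg) set"
  assumes rels_closed: "(x, y) \<in> Rl \<Longrightarrow> x \<in> carrier (free_alg G) \<and> y \<in> carrier (free_alg G)"
begin

abbreviation F where "F \<equiv> free_alg G"
abbreviation P where "P \<equiv> presented_alg G Rl"
abbreviation cl where "cl \<equiv> pres_class G Rl"

sublocale F: ring F by (rule ring_free_alg)

lemma rel_sub: "{x - y | x y. (x, y) \<in> Rl} \<subseteq> carrier F"
  using rels_closed by auto

sublocale I: ideal "rel_ideal G Rl" F
  unfolding rel_ideal_def by (rule F.genideal_ideal[OF rel_sub])

lemma carrier_P: "carrier P = cl ` carrier F"
  by (auto simp: presented_alg_def pres_class_def FactRing_def A_RCOSETS_def' a_r_coset_def' image_iff)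

lemma cl_closed [simp]: "p \<in> carrier F \<Longrightarrow> cl p \<in> carrier P"
  by (simp add: carrier_P)

lemma cl_ops:
  "p \<in> carrier F \<Longrightarrow> p' \<in> carrier F \<Longrightarrow> cl p \<oplus>\<^bsub>P\<^esub> cl p' = cl (p + p')"
  "p \<in> carrier F \<Longrightarrow> p' \<in> carrier F \<Longrightarrow> cl p \<otimes>\<^bsub>P\<^esub> cl p' = cl (p * p')"
  "\<one>\<^bsub>P\<^esub> = cl 1" "\<zero>\<^bsub>P\<^esub> = cl 0"
  "p \<in> carrier F \<Longrightarrow> c \<odot>\<^bsub>P\<^esub> cl p = cl (fconst c * p)"
  using ring_hom_add[OF I.rcos_ring_hom, of p p'] ring_hom_mult[OF I.rcos_ring_hom, of p p']
    ring_hom_mult[OF I.rcos_ring_hom, of "fconst c" p] ring_hom_one[OF I.rcos_ring_hom]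
    F.a_coset_add_zero[OF I.a_subset]
  by (simp_all add: presented_alg_def pres_class_def FactRing_def)

lemma cl_rel: "(x, y) \<in> Rl \<Longrightarrow> cl x = cl y"
proof -
  assume r: "(x, y) \<in> Rl"
  then have "x - y \<in> rel_ideal G Rl"
    unfolding rel_ideal_def using F.genideal_self[OF rel_sub] by auto
  then show ?thesis
    using F.quotient_eq_iff_same_a_r_cos[OF I.ideal_axioms] rels_closed[OF r]
    by (simp add: free_alg_minus pres_class_def)
qed

lemma P_cases: "X \<in> carrier P \<Longrightarrow> (\<And>p. p \<in> carrier F \<Longrightarrow> X = cl p \<Longrightarrow> thesis) \<Longrightarrow> thesis"
  by (auto simp: carrier_P)

sublocale P: complex_algebra P
proof -
  have "abelian_group P"
  proof (rule abelian_groupI)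
    fix X assume "X \<in> carrier P"
    then obtain p where "p \<in> carrier F" "X = cl p" by (rule P_cases)
    then show "\<exists>Y\<in>carrier P. Y \<oplus>\<^bsub>P\<^esub> X = \<zero>\<^bsub>P\<^esub>"
      by (intro bexI[of _ "cl (- p)"]) (auto simp: cl_ops)
  qed (auto elim!: P_cases simp: cl_ops add_ac)
  moreover have "monoid P"
    by (rule monoidI) (auto elim!: P_cases simp: cl_ops mult.assoc)
  ultimately interpret ring P
    by (rule ringI) (auto elim!: P_cases simp: cl_ops distrib_left distrib_right)
  have comm: "p * (fconst c * p') = fconst c * (p * p')" for c and p p' :: "'g falg"
    by (metis mult.assoc fconst_commutes)
  show "complex_algebra P"
  proof
    fix x y c d assume "x \<in> carrier P" "y \<in> carrier P"
    then obtain p p' where p: "p \<in> carrier F" "x = cl p" "p' \<in> carrier F" "y = cl p'"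
      by (auto elim!: P_cases)
    show "c \<odot>\<^bsub>P\<^esub> (x \<oplus>\<^bsub>P\<^esub> y) = c \<odot>\<^bsub>P\<^esub> x \<oplus>\<^bsub>P\<^esub> c \<odot>\<^bsub>P\<^esub> y"
      using p by (simp add: cl_ops distrib_left)
    show "(c \<odot>\<^bsub>P\<^esub> x) \<otimes>\<^bsub>P\<^esub> y = c \<odot>\<^bsub>P\<^esub> (x \<otimes>\<^bsub>P\<^esub> y)"
      using p by (simp add: cl_ops mult.assoc)
    show "x \<otimes>\<^bsub>P\<^esub> (c \<odot>\<^bsub>P\<^esub> y) = c \<odot>\<^bsub>P\<^esub> (x \<otimes>\<^bsub>P\<^esub> y)"
      using p by (simp add: cl_ops comm)
  next
    fix x c d assume "x \<in> carrier P"
    then obtain p where p: "p \<in> carrier F" "x = cl p"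
      by (auto elim!: P_cases)
    show "c \<odot>\<^bsub>P\<^esub> x \<in> carrier P" "1 \<odot>\<^bsub>P\<^esub> x = x"
      using p by (simp_all add: cl_ops fconst_simps)
    show "(c + d) \<odot>\<^bsub>P\<^esub> x = c \<odot>\<^bsub>P\<^esub> x \<oplus>\<^bsub>P\<^esub> d \<odot>\<^bsub>P\<^esub> x"
      using p by (simp add: cl_ops fconst_simps distrib_right)
    show "c \<odot>\<^bsub>P\<^esub> (d \<odot>\<^bsub>P\<^esub> x) = (c * d) \<odot>\<^bsub>P\<^esub> x"
      using p by (simp add: cl_ops fconst_simps mult.assoc)
  qed
qed

lemma cl_sum:
  "finite S \<Longrightarrow> (\<And>i. i \<in> S \<Longrightarrow> f i \<in> carrier F) \<Longrightarrow> cl (sum f S) = (\<Oplus>\<^bsub>P\<^esub>i\<in>S. cl (f i))"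
proof (induction S rule: finite_induct)
  case (insert a S)
  then have "cl (sum f (insert a S)) = cl (f a) \<oplus>\<^bsub>P\<^esub> cl (sum f S)" using cl_ops(1)[of "f a" "sum f S"] by simp
  also have "\<dots> = cl (f a) \<oplus>\<^bsub>P\<^esub> (\<Oplus>\<^bsub>P\<^esub>i\<in>S. cl (f i))" using insert by simp
  finally show ?case using insert by (simp add: Pi_def)
qed (simp add: cl_ops)

lemma cl_pow: "p \<in> carrier F \<Longrightarrow> cl (p ^ k) = cl p [^]\<^bsub>P\<^esub> k"
proof (induction k)
  case (Suc k)
  have "cl (p ^ Suc k) = cl (p ^ k) \<otimes>\<^bsub>P\<^esub> cl p"
    using Suc cl_ops(2)[of "p ^ k" p] by (simp add: power_commutes)
  then show ?case using Suc by simp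
qed (simp add: cl_ops)

text \<open>A class is a linear combination of classes of words, and a word is built by putting
  letters in front; hence the generator step multiplies on the left.\<close>

lemma P_induct [consumes 1, case_names one add smult gen]:
  assumes X: "X \<in> carrier P"
    and one: "Q \<one>\<^bsub>P\<^esub>"
    and add: "\<And>x y. x \<in> carrier P \<Longrightarrow> y \<in> carrier P \<Longrightarrow> Q x \<Longrightarrow> Q y \<Longrightarrow> Q (x \<oplus>\<^bsub>P\<^esub> y)"
    and smult: "\<And>c x. x \<in> carrier P \<Longrightarrow> Q x \<Longrightarrow> Q (c \<odot>\<^bsub>P\<^esub> x)"
    and gen: "\<And>g x. g \<in> G \<Longrightarrow> x \<in> carrier P \<Longrightarrow> Q x \<Longrightarrow> Q (cl (fgen g) \<otimes>\<^bsub>P\<^esub> x)"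
  shows "Q X"
proof -
  obtain p where p: "p \<in> carrier F" "X = cl p" using X by (rule P_cases)
  have word: "Q (cl (prod_list (map fgen us)))" if "set us \<subseteq> G" for us
    using that
  proof (induction us)
    case Nil
    then show ?case using one by (simp add: cl_ops)
  next
    case (Cons g us)
    have "prod_list (map fgen us) \<in> carrier F" using Cons by (intro free_alg_prod_list) auto
    then show ?case using gen[of g "cl (prod_list (map fgen us))"] Cons by (simp add: cl_ops)
  qed
  have single: "Q (cl (Poly_Mapping.single u c)) \<and> Poly_Mapping.single u c \<in> carrier F"
    if "set (letters u) \<subseteq> G" for u c
  proof -
    have "prod_list (map fgen (letters u)) \<in> carrier F" using that by (intro free_alg_prod_list) auto
    then show ?thesis
      using smult[OF _ word[OF that], of c] single_Word[of "letters u" c] by (simp add: cl_ops)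
  qed
  have "Q (cl (\<Sum>u\<in>S. Poly_Mapping.single u (f u))) \<and> (\<Sum>u\<in>S. Poly_Mapping.single u (f u)) \<in> carrier F"
    if "finite S" "\<forall>u\<in>S. set (letters u) \<subseteq> G" for S f
    using that
  proof (induction S rule: finite_induct)
    case empty
    \<comment> \<open>The empty combination is obtained as 0 times the unit, so the induction rule
      has no separate case for zero.\<close>
    then show ?case using smult[OF _ one, of 0] by (simp add: cl_ops fconst_simps)
  next
    case (insert u S)
    then show ?case
      using single[of u "f u"] add[of "cl (Poly_Mapping.single u (f u))" "cl (\<Sum>u\<in>S. Poly_Mapping.single u (f u))"]
      by (simp add: cl_ops)
  qed
  from this[of "Poly_Mapping.keys p" "Poly_Mapping.lookup p"] p
  show ?thesis unfolding poly_mapping_sum_single[symmetric] by (simp add: free_alg_def)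
qed

end

lemma comult_fgen: "comult (fgen g) = comult_gen g"
  by (simp add: comult_def free_lift_def fgen_def fconst_simps)

lemma counit_fgen: "counit (fgen g) = counit_gen g"
  by (simp add: counit_def free_lift_def fgen_def)

lemma tens_single: "tens (Poly_Mapping.single u 1) (Poly_Mapping.single v 1) = Poly_Mapping.single (u, v) 1"
  by (simp add: tens_def)

lemma fgen_mult: "fgen g * fgen g' = Poly_Mapping.single (Word [g, g']) 1"
  by (simp add: fgen_def mult_single plus_fword_def)

section \<open>The action of the quantum algebra\<close>

lemma A_gens_mem [simp]:
  "Zgen i \<in> A_gens n \<longleftrightarrow> i \<in> {1..n}" "Wgen i \<in> A_gens n \<longleftrightarrow> i \<in> {1..n}"
  by (auto simp: A_gens_def)

lemma U_gens_mem [simp]: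
  "Kgen i \<in> U_gens n \<longleftrightarrow> i \<in> {1..n}" "Kinvgen i \<in> U_gens n \<longleftrightarrow> i \<in> {1..n}"
  "Egen i \<in> U_gens n \<longleftrightarrow> i \<in> {1..<n}" "Fgen i \<in> U_gens n \<longleftrightarrow> i \<in> {1..<n}"
  by (auto simp: U_gens_def)

lemma A_rels_closed:
  assumes "(x, y) \<in> A_rels n q"
  shows "x \<in> carrier (free_alg (A_gens n)) \<and> y \<in> carrier (free_alg (A_gens n))"
  using assms by cases (auto intro!: free_alg_closed(5,6) free_alg_sum)

lemma U_rels_closed:
  assumes "(x, y) \<in> U_rels n q h"
  shows "x \<in> carrier (free_alg (U_gens n)) \<and> y \<in> carrier (free_alg (U_gens n))"
  using assms by cases auto

section \<open>The concrete algebras as instances of the abstract setting\<close>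

locale q_param =
  fixes n :: nat and q h :: complex
  assumes q_nz: "q \<noteq> 0" and q_root: "\<And>m::nat. m \<ge> 1 \<Longrightarrow> q ^ m \<noteq> 1" and hq: "h\<^sup>2 = q"
begin

sublocale A: presented "A_gens n" "A_rels n q"
  rewrites "presented_alg (A_gens n) (A_rels n q) = A_alg n q"
    and "pres_class (A_gens n) (A_rels n q) = A_cls n q"
  using A_rels_closed by (unfold_locales) (auto simp: A_alg_def A_cls_def fun_eq_iff)

sublocale U: presented "U_gens n" "U_rels n q h"
  rewrites "presented_alg (U_gens n) (U_rels n q h) = U_alg n q h"
    and "pres_class (U_gens n) (U_rels n q h) = U_cls n q h"
  using U_rels_closed by (unfold_locales) (auto simp: U_alg_def U_cls_def fun_eq_iff)

abbreviation z where "z i \<equiv> A_cls n q (fz i)"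
abbreviation w where "w i \<equiv> A_cls n q (fw i)"

lemma h_nz: "h \<noteq> 0" using hq q_nz by auto

lemma h4: "h ^ 4 = q\<^sup>2"
  using hq by (metis mult_2_right numeral_Bit0 power_even_eq power_mult)

sublocale qspace "A_alg n q" n h z w
proof
  show "h \<noteq> 0" "h ^ 4 \<noteq> 1" using h_nz h4 q_root[of 2] by auto
  show "z j \<in> carrier (A_alg n q)" "w j \<in> carrier (A_alg n q)" if "j \<in> {1..n}" for j
    using that by auto
  show "z k \<otimes>\<^bsub>A_alg n q\<^esub> z j = h\<^sup>2 \<odot>\<^bsub>A_alg n q\<^esub> (z j \<otimes>\<^bsub>A_alg n q\<^esub> z k)"
    if "1 \<le> k" "k < j" "j \<le> n" for k j
    using A.cl_rel[OF A_rels.zz[OF that]] that by (simp add: A.cl_ops hq mult.assoc)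
  show "w k \<otimes>\<^bsub>A_alg n q\<^esub> w j = (inverse h)\<^sup>2 \<odot>\<^bsub>A_alg n q\<^esub> (w j \<otimes>\<^bsub>A_alg n q\<^esub> w k)"
    if "1 \<le> k" "k < j" "j \<le> n" for k j
    using A.cl_rel[OF A_rels.ww[OF that]] that by (simp add: A.cl_ops hq mult.assoc power_inverse)
  show "w j \<otimes>\<^bsub>A_alg n q\<^esub> z k = h\<^sup>2 \<odot>\<^bsub>A_alg n q\<^esub> (z k \<otimes>\<^bsub>A_alg n q\<^esub> w j)"
    if "k \<in> {1..n}" "j \<in> {1..n}" "k \<noteq> j" for k j
    using A.cl_rel[OF A_rels.wz[OF that]] that by (simp add: A.cl_ops hq mult.assoc)
  show "w k \<otimes>\<^bsub>A_alg n q\<^esub> z k = z k \<otimes>\<^bsub>A_alg n q\<^esub> w k \<oplus>\<^bsub>A_alg n q\<^esub>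
      (1 - h ^ 4) \<odot>\<^bsub>A_alg n q\<^esub> (\<Oplus>\<^bsub>A_alg n q\<^esub>s\<in>{1..<k}. z s \<otimes>\<^bsub>A_alg n q\<^esub> w s)"
    if k: "k \<in> {1..n}" for k
  proof -
    have s: "(\<Sum>s\<in>{1..<k}. fz s * fw s) \<in> carrier (free_alg (A_gens n))"
      using k by (intro free_alg_sum) auto
    have "(\<Oplus>\<^bsub>A_alg n q\<^esub>s\<in>{1..<k}. z s \<otimes>\<^bsub>A_alg n q\<^esub> w s) =
      (\<Oplus>\<^bsub>A_alg n q\<^esub>s\<in>{1..<k}. A_cls n q (fz s * fw s))"
      using k by (intro A.P.add.finprod_cong') (auto simp: A.cl_ops)
    also have "\<dots> = A_cls n q (\<Sum>s\<in>{1..<k}. fz s * fw s)"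
      using k by (intro A.cl_sum[symmetric]) auto
    finally show ?thesis
      using A.cl_rel[OF A_rels.wz_diag[OF k]] k s by (simp add: A.cl_ops h4)
  qed
  show "P p" if "p \<in> carrier (A_alg n q)" "P \<one>\<^bsub>A_alg n q\<^esub>"
      "\<And>x y. x \<in> carrier (A_alg n q) \<Longrightarrow> y \<in> carrier (A_alg n q) \<Longrightarrow> P x \<Longrightarrow> P y \<Longrightarrow> P (x \<oplus>\<^bsub>A_alg n q\<^esub> y)"
      "\<And>c x. x \<in> carrier (A_alg n q) \<Longrightarrow> P x \<Longrightarrow> P (c \<odot>\<^bsub>A_alg n q\<^esub> x)"
      "\<And>j x. j \<in> {1..n} \<Longrightarrow> x \<in> carrier (A_alg n q) \<Longrightarrow> P x \<Longrightarrow> P (z j \<otimes>\<^bsub>A_alg n q\<^esub> x)"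
      "\<And>j x. j \<in> {1..n} \<Longrightarrow> x \<in> carrier (A_alg n q) \<Longrightarrow> P x \<Longrightarrow> P (w j \<otimes>\<^bsub>A_alg n q\<^esub> x)"
    for p P
    using that(1)
  proof (induction p rule: A.P_induct)
    case (gen g x)
    then show ?case using that(5,6) by (auto simp: A_gens_def)
  qed (use that in auto)
qed

text \<open>Membership of the representative in the free algebra is carried through the induction,
  since a product of classes is computed only for such representatives.\<close>

lemma cl_mon:
  assumes "\<And>i. i \<in> {1..m} \<Longrightarrow> f i \<in> carrier (free_alg (A_gens n))"
  shows "A_cls n q (prod_list (map (\<lambda>i. f i ^ r i) [1..<Suc m])) = A.P.omon (\<lambda>i. A_cls n q (f i)) m r \<and>
    prod_list (map (\<lambda>i. f i ^ r i) [1..<Suc m]) \<in> carrier (free_alg (A_gens n))"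
  using assms
proof (induction m)
  case 0
  then show ?case by (simp add: A.cl_ops)
next
  case (Suc m)
  then have IH: "A_cls n q (prod_list (map (\<lambda>i. f i ^ r i) [1..<Suc m])) = A.P.omon (\<lambda>i. A_cls n q (f i)) m r"
    "prod_list (map (\<lambda>i. f i ^ r i) [1..<Suc m]) \<in> carrier (free_alg (A_gens n))" by auto
  have f: "f (Suc m) \<in> carrier (free_alg (A_gens n))" using Suc.prems by auto
  have "prod_list (map (\<lambda>i. f i ^ r i) [1..<Suc (Suc m)]) =
    prod_list (map (\<lambda>i. f i ^ r i) [1..<Suc m]) * f (Suc m) ^ r (Suc m)" by simp
  moreover have "A.P.omon (\<lambda>i. A_cls n q (f i)) (Suc m) r =
    A_cls n q (prod_list (map (\<lambda>i. f i ^ r i) [1..<Suc m])) \<otimes>\<^bsub>A_alg n q\<^esub> A_cls n q (f (Suc m) ^ r (Suc m))"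
    unfolding IH using f by (simp add: A.cl_pow)
  ultimately show ?case using IH(2) f by (simp only: A.cl_ops(2) free_alg_closed simp_thms)
qed

lemma cl_zmon: "A_cls n q (zmon n r * wmon n s) = A.P.omon z n r \<otimes>\<^bsub>A_alg n q\<^esub> A.P.omon w n s"
  and cl_wmon: "A_cls n q (wmon n r * zmon n s) = A.P.omon w n r \<otimes>\<^bsub>A_alg n q\<^esub> A.P.omon z n s"
  using cl_mon[of n fz r] cl_mon[of n fw s] cl_mon[of n fz s] cl_mon[of n fw r]
  by (simp_all add: zmon_def wmon_def A.cl_ops(2)[symmetric] del: upt_Suc)

end

locale q_setup = q_param n q h for n q h +
  fixes D Dbar :: "nat \<Rightarrow> agen falg set \<Rightarrow> agen falg set"
    and L :: "ugen falg set \<Rightarrow> agen falg set \<Rightarrow> agen falg set"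
  assumes D: "\<And>i. i \<in> {1..n} \<Longrightarrow> is_partial n q i (D i)"
    and Dbar: "\<And>i. i \<in> {1..n} \<Longrightarrow> is_partial_bar n q i (Dbar i)"
    and L: "is_L_action n q h L"
begin

sublocale qspace_diff "A_alg n q" n h z w D Dbar
proof
  fix j r s assume j: "j \<in> {1..n}"
  show "linear_operator (A_alg n q) (D j)" "linear_operator (A_alg n q) (Dbar j)"
    using D[OF j] Dbar[OF j] by (auto simp: is_partial_def is_partial_bar_def)
  show "D j (A.P.omon z n r \<otimes>\<^bsub>A_alg n q\<^esub> A.P.omon w n s) = ((h\<^sup>2) ^ tail n j r * qnum (h\<^sup>2) (int (r j)))
      \<odot>\<^bsub>A_alg n q\<^esub> (A.P.omon z n (r(j := r j - 1)) \<otimes>\<^bsub>A_alg n q\<^esub> A.P.omon w n s)"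
    using D[OF j] unfolding is_partial_def cl_zmon hq tail_def by simp
  show "Dbar j (A.P.omon w n r \<otimes>\<^bsub>A_alg n q\<^esub> A.P.omon z n s) = ((inverse (h\<^sup>2)) ^ tail n j r * qnum (h\<^sup>2) (int (r j)))
      \<odot>\<^bsub>A_alg n q\<^esub> (A.P.omon w n (r(j := r j - 1)) \<otimes>\<^bsub>A_alg n q\<^esub> A.P.omon z n s)"
    using Dbar[OF j] unfolding is_partial_bar_def cl_wmon hq tail_def
    by (simp add: power_int_minus power_inverse del: of_nat_sum)
qed

lemma q_laplace_eq: "q_laplace n q D Dbar p = laplace p"
  by (simp add: q_laplace_def laplace_def)

lemma Q_elem_eq: "Q_elem n q = Q"
proof -
  have "Q_elem n q = (\<Oplus>\<^bsub>A_alg n q\<^esub>s\<in>{1..n}. A_cls n q (fz s * fw s))"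
    unfolding Q_elem_def by (intro A.cl_sum) auto
  also have "\<dots> = Q"
    unfolding Q_def by (intro A.P.add.finprod_cong') (auto simp: A.cl_ops)
  finally show ?thesis .
qed

abbreviation op where "op g \<equiv> L (U_cls n q h (fgen g))"

lemma rep: "algebra_representation (U_alg n q h) (A_alg n q) L"
  using L by (simp add: is_L_action_def)

lemma L_lin: "X \<in> carrier (U_alg n q h) \<Longrightarrow> linear_operator (A_alg n q) (L X)"
  using rep by (simp add: algebra_representation_def)

lemma L_mult: "X \<in> carrier (U_alg n q h) \<Longrightarrow> Y \<in> carrier (U_alg n q h) \<Longrightarrow> p \<in> carrier (A_alg n q) \<Longrightarrow>
    L (X \<otimes>\<^bsub>U_alg n q h\<^esub> Y) p = L X (L Y p)"
  using rep by (simp add: algebra_representation_def)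

lemma op_mult:
  assumes "g \<in> U_gens n" "g' \<in> U_gens n" "p \<in> carrier (A_alg n q)"
  shows "L (U_cls n q h (fgen g * fgen g')) p = op g (op g' p)"
  using L_mult[of "U_cls n q h (fgen g)" "U_cls n q h (fgen g')" p] assms by (simp add: U.cl_ops)

lemma op_lin: "g \<in> U_gens n \<Longrightarrow> linear_operator (A_alg n q) (op g)"
  by (intro L_lin) auto

lemma op_one: "g \<in> U_gens n \<Longrightarrow> op g \<one>\<^bsub>A_alg n q\<^esub> = counit_gen g \<odot>\<^bsub>A_alg n q\<^esub> \<one>\<^bsub>A_alg n q\<^esub>"
  using L by (simp add: is_L_action_def counit_fgen)

lemma op_prod:
  assumes "g \<in> U_gens n" "p \<in> carrier (A_alg n q)" "p' \<in> carrier (A_alg n q)"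
  shows "op g (p \<otimes>\<^bsub>A_alg n q\<^esub> p') =
    (\<Oplus>\<^bsub>A_alg n q\<^esub>t\<in>Poly_Mapping.keys (comult_gen g). Poly_Mapping.lookup (comult_gen g) t \<odot>\<^bsub>A_alg n q\<^esub>
      (L (U_cls n q h (Poly_Mapping.single (fst t) 1)) p \<otimes>\<^bsub>A_alg n q\<^esub>
       L (U_cls n q h (Poly_Mapping.single (snd t) 1)) p'))"
  using L assms by (simp add: is_L_action_def comult_fgen)

lemma op_group_like:
  assumes "comult_gen g = tens (fgen g) (fgen g)" "counit_gen g = 1" "g \<in> U_gens n"
  shows "A.P.multiplicative (op g)"
proof -
  have c: "comult_gen g = Poly_Mapping.single (Word [g], Word [g]) 1"
    unfolding assms(1) fgen_def by (rule tens_single)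
  have "op g (p \<otimes>\<^bsub>A_alg n q\<^esub> p') = op g p \<otimes>\<^bsub>A_alg n q\<^esub> op g p'"
    if "p \<in> carrier (A_alg n q)" "p' \<in> carrier (A_alg n q)" for p p'
    using op_prod[OF assms(3) that] A.P.lin_closed[OF op_lin[OF assms(3)]] that
    unfolding c by (simp add: fgen_def)
  then show ?thesis
    using op_lin op_one assms unfolding A.P.multiplicative_def by simp
qed

text \<open>The Sweedler sum of such a generator has two terms, which are the two summands of the
  twisted Leibniz rule; the counit value 0 makes the unit vanish.\<close>

lemma op_skew:
  assumes c: "comult_gen g = tens (fgen g) (fgen a * fgen b) + tens (fgen c * fgen d) (fgen g)"
    and "counit_gen g = 0" and g: "g \<in> U_gens n" "a \<in> U_gens n" "b \<in> U_gens n" "c \<in> U_gens n" "d \<in> U_gens n"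
    and K: "A.P.multiplicative (\<lambda>p. op c (op d p))" "A.P.multiplicative (\<lambda>p. op a (op b p))"
  shows "skew (A_alg n q) (op g) (\<lambda>p. op c (op d p)) (\<lambda>p. op a (op b p))"
proof
  show "linear_operator (A_alg n q) (op g)" using g by (intro op_lin)
  show "op g \<one>\<^bsub>A_alg n q\<^esub> = \<zero>\<^bsub>A_alg n q\<^esub>" using op_one[OF g(1)] assms by simp
  fix p p' assume p: "p \<in> carrier (A_alg n q)" "p' \<in> carrier (A_alg n q)"
  let ?u = "(Word [g], Word [a, b])" and ?v = "(Word [c, d], Word [g])"
  have c': "comult_gen g = Poly_Mapping.single ?u 1 + Poly_Mapping.single ?v 1"
    unfolding c fgen_mult by (simp add: fgen_def tens_single)
  \<comment> \<open>The one-letter and two-letter words occur in opposite slots, so the two tensors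
    are distinct and do not merge into one key.\<close>
  have keys: "Poly_Mapping.keys (comult_gen g) = {?u, ?v}"
    unfolding c' by (auto simp: in_keys_iff lookup_add lookup_single when_def split: if_splits)
  have lookup: "Poly_Mapping.lookup (comult_gen g) ?u = 1" "Poly_Mapping.lookup (comult_gen g) ?v = 1"
    unfolding c' by (simp_all add: lookup_add lookup_single when_def)
  have L1: "L (U_cls n q h (Poly_Mapping.single (Word [g]) 1)) r = op g r" for r
    by (simp add: fgen_def)
  have L2: "L (U_cls n q h (Poly_Mapping.single (Word [a, b]) 1)) r = op a (op b r)"
    "L (U_cls n q h (Poly_Mapping.single (Word [c, d]) 1)) r = op c (op d r)"
    if "r \<in> carrier (A_alg n q)" for r
    using that g unfolding fgen_mult[symmetric] by (auto simp: op_mult)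
  note lin = A.P.lin_closed[OF op_lin]
  show "op g (p \<otimes>\<^bsub>A_alg n q\<^esub> p') = op g p \<otimes>\<^bsub>A_alg n q\<^esub> op a (op b p') \<oplus>\<^bsub>A_alg n q\<^esub>
      op c (op d p) \<otimes>\<^bsub>A_alg n q\<^esub> op g p'"
    unfolding op_prod[OF g(1) p] keys using p g by (simp add: lookup L1 L2 lin)
qed (fact K)+

lemma op_Kgen: "i \<in> {1..n} \<Longrightarrow> A.P.multiplicative (op (Kgen i))"
  and op_Kinvgen: "i \<in> {1..n} \<Longrightarrow> A.P.multiplicative (op (Kinvgen i))"
  by (rule op_group_like; simp)+

lemma op_K:
  assumes "i \<in> {1..n}" "j \<in> {1..n}"
  shows "op (Kgen i) (z j) = (if j = i then h else 1) \<odot>\<^bsub>A_alg n q\<^esub> z j"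
    "op (Kgen i) (w j) = inverse (if j = i then h else 1) \<odot>\<^bsub>A_alg n q\<^esub> w j"
  using L assms unfolding is_L_action_def by (auto simp: A.cl_ops)

text \<open>The action prescribes values of k_i^(1/2) only; those of its inverse follow from the
  relation k_i^(-1/2) k_i^(1/2) = 1, applied to eigenvectors with nonzero eigenvalue.\<close>

lemma op_Kinv:
  assumes "i \<in> {1..n}" "j \<in> {1..n}"
  shows "op (Kinvgen i) (z j) = inverse (if j = i then h else 1) \<odot>\<^bsub>A_alg n q\<^esub> z j"
    "op (Kinvgen i) (w j) = (if j = i then h else 1) \<odot>\<^bsub>A_alg n q\<^esub> w j"
proof -
  have inv: "op (Kinvgen i) (op (Kgen i) p) = p" if p: "p \<in> carrier (A_alg n q)" for p
  proof -
    have "op (Kinvgen i) (op (Kgen i) p) = L (U_cls n q h (fKinv i * fK i)) p"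
      using assms p by (simp add: op_mult)
    also have "U_cls n q h (fKinv i * fK i) = \<one>\<^bsub>U_alg n q h\<^esub>"
      using U.cl_rel[OF U_rels.Kinv_K[OF assms(1)]] by (simp add: U.cl_ops)
    finally show ?thesis using rep p by (simp add: algebra_representation_def)
  qed
  have *: "op (Kinvgen i) p = inverse c \<odot>\<^bsub>A_alg n q\<^esub> p"
    if p: "p \<in> carrier (A_alg n q)" and "op (Kgen i) p = c \<odot>\<^bsub>A_alg n q\<^esub> p" "c \<noteq> 0" for c p
  proof -
    have lin: "linear_operator (A_alg n q) (op (Kinvgen i))" using assms by (intro op_lin) simp
    have "c \<odot>\<^bsub>A_alg n q\<^esub> op (Kinvgen i) p = p"
      using inv[OF p] that A.P.lin_smult[OF lin p] by simp
    then show ?thesis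
      using A.P.smult_cancel[of c "op (Kinvgen i) p" p] that A.P.lin_closed[OF lin p]
      by (simp add: divide_inverse)
  qed
  show "op (Kinvgen i) (z j) = inverse (if j = i then h else 1) \<odot>\<^bsub>A_alg n q\<^esub> z j"
    using op_K(1)[OF assms] assms h_nz by (intro *) auto
  show "op (Kinvgen i) (w j) = (if j = i then h else 1) \<odot>\<^bsub>A_alg n q\<^esub> w j"
    using *[OF _ op_K(2)[OF assms]] assms h_nz by auto
qed

text \<open>Both claims are bundled so that a single induction over the quantum algebra proves
  them.\<close>

definition commutes :: "(agen falg set \<Rightarrow> agen falg set) \<Rightarrow> bool" where
  "commutes T \<longleftrightarrow> (\<forall>p\<in>carrier (A_alg n q).
    laplace (T p) = T (laplace p) \<and> Q \<otimes>\<^bsub>A_alg n q\<^esub> T p = T (Q \<otimes>\<^bsub>A_alg n q\<^esub> p))"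

lemma commutes_group_like:
  assumes "A.P.multiplicative H" "\<And>j. j \<in> {1..n} \<Longrightarrow> H (z j) = \<chi> j \<odot>\<^bsub>A_alg n q\<^esub> z j"
    and "\<And>j. j \<in> {1..n} \<Longrightarrow> H (w j) = inverse (\<chi> j) \<odot>\<^bsub>A_alg n q\<^esub> w j"
    and "\<And>j. j \<in> {1..n} \<Longrightarrow> \<chi> j \<noteq> 0"
  shows "commutes H"
  using laplace_group_like[OF assms] Q_group_like[OF assms] assms(1) by (simp add: commutes_def)

lemma commutes_K: "i \<in> {1..n} \<Longrightarrow> commutes (op (Kgen i))"
  using h_nz op_K by (intro commutes_group_like[where \<chi> = "\<lambda>j. if j = i then h else 1"] op_Kgen) auto

lemma commutes_Kinv: "i \<in> {1..n} \<Longrightarrow> commutes (op (Kinvgen i))"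
  using h_nz op_Kinv by (intro commutes_group_like[where \<chi> = "\<lambda>j. inverse (if j = i then h else 1)"] op_Kinvgen) auto

context
  fixes i assumes i: "1 \<le> i" "i < n"
begin

text \<open>The group-like factors in the comultiplication of e_i and f_i: \<open>KK\<close> stands
  in the left slot beside the generator, \<open>KK'\<close> in the right slot.\<close>

abbreviation (input) "KK \<equiv> \<lambda>p. op (Kgen i) (op (Kinvgen (i + 1)) p)"
abbreviation (input) "KK' \<equiv> \<lambda>p. op (Kinvgen i) (op (Kgen (i + 1)) p)"

lemma KK_mult: "A.P.multiplicative KK" "A.P.multiplicative KK'"
proof -
  have *: "A.P.multiplicative (\<lambda>p. S (T p))" if "A.P.multiplicative S" "A.P.multiplicative T" for S T
    using that A.P.lin_comp unfolding A.P.multiplicative_def by (auto simp: A.P.lin_closed)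
  show "A.P.multiplicative KK" "A.P.multiplicative KK'"
    by (rule *[OF op_Kgen op_Kinvgen] *[OF op_Kinvgen op_Kgen]; use i in simp)+
qed

lemma KK_char:
  assumes j: "j \<in> {1..n}"
  shows "KK (z j) = (if j = i then h else if j = i + 1 then inverse h else 1) \<odot>\<^bsub>A_alg n q\<^esub> z j"
    "KK' (z j) = (if j = i then inverse h else if j = i + 1 then h else 1) \<odot>\<^bsub>A_alg n q\<^esub> z j"
    "KK (w j) = (if j = i then inverse h else if j = i + 1 then h else 1) \<odot>\<^bsub>A_alg n q\<^esub> w j"
    "KK' (w j) = (if j = i then h else if j = i + 1 then inverse h else 1) \<odot>\<^bsub>A_alg n q\<^esub> w j"
  using i j op_Kgen[of i] op_Kinvgen[of i] op_K[OF _ j] op_Kinv[OF _ j]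
  by (simp_all add: A.P.lin_smult)

lemma skew_E: "qspace_skew (A_alg n q) n h z w D Dbar (op (Egen i)) KK KK' i"
proof -
  interpret skew "A_alg n q" "op (Egen i)" KK KK'
    using i KK_mult by (intro op_skew) simp_all
  show ?thesis by standard (use i KK_char in auto)
qed

lemma skew_F: "qspace_skew (A_alg n q) n h z w D Dbar (op (Fgen i)) KK KK' i"
proof -
  interpret skew "A_alg n q" "op (Fgen i)" KK KK'
    using i KK_mult by (intro op_skew) simp_all
  show ?thesis by standard (use i KK_char in auto)
qed

lemma Q_commutes_skew:
  assumes "skew (A_alg n q) E KK KK'" "E Q = \<zero>\<^bsub>A_alg n q\<^esub>" "p \<in> carrier (A_alg n q)"
  shows "Q \<otimes>\<^bsub>A_alg n q\<^esub> E p = E (Q \<otimes>\<^bsub>A_alg n q\<^esub> p)"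
proof -
  interpret skew "A_alg n q" E KK KK' by (rule assms(1))
  have "KK Q = Q"
    by (rule Q_group_like[OF KK_mult(1),
          where \<chi> = "\<lambda>j. if j = i then h else if j = i + 1 then inverse h else 1"])
      (use KK_char h_nz in auto)
  moreover have "KK' p \<in> carrier (A_alg n q)"
    using A.P.lin_closed[OF A.P.multD(1)[OF KK_mult(2)] assms(3)] .
  ultimately show ?thesis using assms E_lin by (simp add: E_mult)
qed

lemma commutes_E: "commutes (op (Egen i))"
proof -
  interpret S: qspace_skew "A_alg n q" n h z w D Dbar "op (Egen i)" KK KK' i by (rule skew_E)
  have Ez: "op (Egen i) (z j) = (if j = i + 1 then z i else \<zero>\<^bsub>A_alg n q\<^esub>)"
    and Ew: "op (Egen i) (w j) = (if j = i then (- inverse (h\<^sup>2)) \<odot>\<^bsub>A_alg n q\<^esub> w (i + 1) else \<zero>\<^bsub>A_alg n q\<^esub>)"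
    if "j \<in> {1..n}" for j
    using L i that unfolding is_L_action_def by (auto simp: A.cl_ops hq)
  \<comment> \<open>The balance of the two coefficients is h^(-1) + h (-h^(-2)) = 0.\<close>
  have "op (Egen i) Q = \<zero>\<^bsub>A_alg n q\<^esub>"
    unfolding Q_def
    by (rule S.Q_invariant[where a = "i + 1" and b = i and c = "- inverse (h\<^sup>2)"])
      (use i Ez Ew h_nz in \<open>auto simp: power2_eq_square\<close>)
  then show ?thesis
    using S.laplace_lowering[OF Ez Ew] Q_commutes_skew[OF S.skew_axioms] by (simp add: commutes_def)
qed

lemma commutes_F: "commutes (op (Fgen i))"
proof -
  interpret S: qspace_skew "A_alg n q" n h z w D Dbar "op (Fgen i)" KK KK' i by (rule skew_F)
  have Ez: "op (Fgen i) (z j) = (if j = i then z (i + 1) else \<zero>\<^bsub>A_alg n q\<^esub>)"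
    and Ew: "op (Fgen i) (w j) = (if j = i + 1 then (- h\<^sup>2) \<odot>\<^bsub>A_alg n q\<^esub> w i else \<zero>\<^bsub>A_alg n q\<^esub>)"
    if "j \<in> {1..n}" for j
    using L i that unfolding is_L_action_def by (auto simp: A.cl_ops hq)
  \<comment> \<open>The balance of the two coefficients is h + h^(-1) (-h^2) = 0.\<close>
  have "op (Fgen i) Q = \<zero>\<^bsub>A_alg n q\<^esub>"
    unfolding Q_def
    by (rule S.Q_invariant[where a = i and b = "i + 1" and c = "- h\<^sup>2"])
      (use i Ez Ew h_nz in \<open>auto simp: power2_eq_square\<close>)
  then show ?thesis
    using S.laplace_raising[OF Ez Ew] Q_commutes_skew[OF S.skew_axioms] by (simp add: commutes_def)
qed

end

text \<open>A generator multiplied from the left becomes, under \<open>L\<close>, a composition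
  \<open>op g\<close> after \<open>L X\<close>, and commuting passes through compositions.\<close>

lemma commutes_L: "X \<in> carrier (U_alg n q h) \<Longrightarrow> commutes (L X)"
proof (induction X rule: U.P_induct)
  case one
  then show ?case using rep by (simp add: commutes_def algebra_representation_def)
next
  case (add X Y)
  then show ?case using rep laplace_lin
    by (simp add: commutes_def algebra_representation_def A.P.lin_add A.P.r_distr)
next
  case (smult c X)
  then show ?case using rep laplace_lin
    by (simp add: commutes_def algebra_representation_def A.P.lin_smult)
next
  case (gen g X)
  have "commutes (op g)"
    using gen(1) commutes_K commutes_Kinv commutes_E commutes_F by (auto simp: U_gens_def)
  then show ?case using gen L_lin[of X] by (simp add: commutes_def L_mult)
qed

end

theorem proposition2:
  fixes n :: nat and q h :: complex
    and D Dbar :: "nat \<Rightarrow> agen falg set \<Rightarrow> agen falg set"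
    and L :: "ugen falg set \<Rightarrow> agen falg set \<Rightarrow> agen falg set"
  assumes "n \<ge> 1"
    and "q \<noteq> 0"
    and "\<And>m::nat. m \<ge> 1 \<Longrightarrow> q ^ m \<noteq> 1"
    and "h\<^sup>2 = q"
    and "\<And>i. i \<in> {1..n} \<Longrightarrow> is_partial n q i (D i)"
    and "\<And>i. i \<in> {1..n} \<Longrightarrow> is_partial_bar n q i (Dbar i)"
    and "is_L_action n q h L"
  shows "\<forall>X\<in>carrier (U_alg n q h). \<forall>p\<in>carrier (A_alg n q).
    q_laplace n q D Dbar (L X p) = L X (q_laplace n q D Dbar p) \<and>
    Q_hat n q (L X p) = L X (Q_hat n q p)"
proof -
  interpret q_setup n q h D Dbar L
    using assms(2-7) by unfold_locales
  show ?thesis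
    using commutes_L by (simp add: q_laplace_eq Q_hat_def Q_elem_eq commutes_def)
qed

end
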